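(* Let $P$ be a full-dimensional polytope in $\mathbb{P}^n$ with $d$ facets. If the hyperplane arrangement $\mathcal{H}_P$ is simple, there is a unique hypersurface $A_P$ in $\mathbb{P}^n$ of degree $d-n-1$ which vanishes along the residual arrangement $\mathcal{R}_P$.
   Context: $\mathbb{P}^n$ is complex projective $n$-space. A full-dimensional polytope $P$ in $\mathbb{P}^n$ is the collection of the Zariski closures in $\mathbb{P}^n$ of the (nonempty) faces of a full-dimensional convex polytope in an affine chart $\mathbb{R}^n\subset\mathbb{P}^n$. $\mathcal{H}_P$ is the arrangement of hyperplanes spanned by the facets of $P$. It is called simple if through any point of $\mathbb{P}^n$ pass at most $n$ hyperplanes of $\mathcal{H}_P$. The residual arrangement $\mathcal{R}_P$ of $P$ consists of (is the union of) all linear spaces that are intersections of hyperplanes in $\mathcal{H}_P$ and do not contain any face of $P$. A hypersurface of degree $m$ is given by a nonzero homogeneous form of degree $m$ up to scalar (for $m=0$ this is a nonzero constant, with empty zero set). *)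

theory Defs
  imports "HOL-Analysis.Analysis" "HOL-Library.Poly_Mapping"
begin

text \<open>
  A point of complex projective space with homogeneous coordinates indexed by \<open>'k\<close> is a
  one-dimensional linear subspace of \<open>complex ^ 'k\<close>.
\<close>

type_synonym 'k ppoint = "(complex ^ 'k) set"

definition ppoint :: "complex ^ 'k \<Rightarrow> 'k::finite ppoint"
  where "ppoint v = range (\<lambda>c. c *s v)"

definition proj_space :: "'k::finite ppoint set"
  where "proj_space = {ppoint v | v. v \<noteq> 0}"

text \<open>Polynomials: finitely supported maps from exponent vectors to coefficients.\<close>

type_synonym 'k mpoly = "('k \<Rightarrow>\<^sub>0 nat) \<Rightarrow>\<^sub>0 complex"

definition mpoly_eval :: "'k::finite mpoly \<Rightarrow> complex ^ 'k \<Rightarrow> complex"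
  where "mpoly_eval F v =
    (\<Sum>t\<in>Poly_Mapping.keys F.
      Poly_Mapping.lookup F t * (\<Prod>i\<in>UNIV. (v $ i) ^ Poly_Mapping.lookup t i))"

text \<open>The zero polynomial is a form of every degree.\<close>

definition form :: "nat \<Rightarrow> 'k::finite mpoly \<Rightarrow> bool"
  where "form m F \<longleftrightarrow> (\<forall>t\<in>Poly_Mapping.keys F. (\<Sum>i\<in>UNIV. Poly_Mapping.lookup t i) = m)"

text \<open>
  Only used for forms. All representatives of a point are tested, including the vector \<open>0\<close>;
  this is harmless in positive degree, and a nonzero constant vanishes nowhere.
\<close>

definition vanishes_at :: "'k::finite mpoly \<Rightarrow> 'k ppoint \<Rightarrow> bool"
  where "vanishes_at F p \<longleftrightarrow> (\<forall>v\<in>p. mpoly_eval F v = 0)"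

definition zariski_closed :: "'k::finite ppoint set \<Rightarrow> bool"
  where "zariski_closed X \<longleftrightarrow>
    (\<exists>S. (\<forall>F\<in>S. \<exists>m. form m F) \<and> X = {p \<in> proj_space. \<forall>F\<in>S. vanishes_at F p})"

definition zariski_closure :: "'k::finite ppoint set \<Rightarrow> 'k ppoint set"
  where "zariski_closure A = \<Inter>{X. zariski_closed X \<and> A \<subseteq> X}"

definition proj_span :: "'k::finite ppoint set \<Rightarrow> 'k ppoint set"
  where "proj_span X = {p \<in> proj_space. p \<subseteq> vec.span (\<Union>X)}"

definition scalar_class :: "'k::finite mpoly \<Rightarrow> 'k mpoly set"
  where "scalar_class F = {Poly_Mapping.map ((*) c) F | c. c \<noteq> 0}"

definition hypersurfaces :: "nat \<Rightarrow> 'k::finite mpoly set set"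
  where "hypersurfaces m = {scalar_class F | F. form m F \<and> F \<noteq> 0}"

definition vanishes_along :: "'k::finite mpoly set \<Rightarrow> 'k ppoint set \<Rightarrow> bool"
  where "vanishes_along A R \<longleftrightarrow> (\<forall>F\<in>A. \<forall>p\<in>R. vanishes_at F p)"

text \<open>
  Projective \<open>n\<close>-space for \<open>n = CARD('n)\<close> has homogeneous coordinates indexed by
  \<open>'n option\<close>, where \<open>None\<close> is the homogenizing coordinate. An affine chart
  is the standard chart \<open>x \<mapsto> (1 : x)\<close> followed by the projective transformation
  given by an invertible complex matrix \<open>M\<close>.
\<close>

definition homogenize :: "real ^ 'n::finite \<Rightarrow> complex ^ ('n option)"
  where "homogenize x = (\<chi> i. case i of None \<Rightarrow> 1 | Some j \<Rightarrow> complex_of_real (x $ j))"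

definition chart ::
  "complex ^ ('n option) ^ ('n option) \<Rightarrow> real ^ 'n::finite \<Rightarrow> ('n option) ppoint"
  where "chart M x = ppoint (M *v homogenize x)"

text \<open>
  \<open>proj_polytope M Q\<close> is the polytope in projective space (as the collection of its
  faces) coming from the convex polytope \<open>Q\<close> in the chart \<open>M\<close>.
\<close>

definition proj_polytope ::
  "complex ^ ('n option) ^ ('n option) \<Rightarrow> (real ^ 'n::finite) set \<Rightarrow> ('n option) ppoint set set"
  where "proj_polytope M Q = {zariski_closure (chart M ` F) | F. F face_of Q \<and> F \<noteq> {}}"

definition proj_facets ::
  "complex ^ ('n option) ^ ('n option) \<Rightarrow> (real ^ 'n::finite) set \<Rightarrow> ('n option) ppoint set set"
  where "proj_facets M Q = {zariski_closure (chart M ` F) | F. F facet_of Q}"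

definition facet_arrangement ::
  "complex ^ ('n option) ^ ('n option) \<Rightarrow> (real ^ 'n::finite) set \<Rightarrow> ('n option) ppoint set set"
  where "facet_arrangement M Q = proj_span ` proj_facets M Q"

definition simple_arrangement :: "('n::finite option) ppoint set set \<Rightarrow> bool"
  where "simple_arrangement \<H> \<longleftrightarrow>
    (\<forall>p\<in>proj_space. finite {H \<in> \<H>. p \<in> H} \<and> card {H \<in> \<H>. p \<in> H} \<le> CARD('n))"

definition residual_arrangement ::
  "complex ^ ('n option) ^ ('n option) \<Rightarrow> (real ^ 'n::finite) set \<Rightarrow> ('n option) ppoint set"
  where "residual_arrangement M Q =
    \<Union>{L. (\<exists>S. S \<noteq> {} \<and> S \<subseteq> facet_arrangement M Q \<and> L = \<Inter>S) \<and>
         \<not> (\<exists>X\<in>proj_polytope M Q. X \<subseteq> L)}"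

end

theory Submission
  imports Defs
begin

text \<open>
  Let \<open>d\<close> be the number of facets and \<open>m = d - n - 1\<close>. Passing to homogeneous coordinates
  replaces the polytope by the cone over it in \<open>(n + 1)\<close>-space, cut out by \<open>d\<close> real linear forms,
  one for each facet. Simplicity of the arrangement says that any \<open>n + 1\<close> of these forms are
  linearly independent, and a stratum of the arrangement (the common zeros of a set of forms) lies
  in the residual arrangement iff it meets the cone only in \<open>0\<close>. In particular a vertex of the
  cone lies on exactly \<open>n\<close> facets, and on a line of the arrangement exactly two points of
  the arrangement, or none, are vertices of the cone; the others are residual. All of this lives
  in the locale \<open>simple_cone\<close>, where a point is described by the set of forms vanishing at it.

  The tool behind both halves is a count of zeros (\<open>form_vanishes_from_points\<close>): a form of degree
  \<open>m\<close> that vanishes at every point of the arrangement in a stratum vanishes on the stratum.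
  Indeed a line of the arrangement carries \<open>d - n + 1 > m\<close> points, and a generic line in a stratum
  of higher dimension meets more than \<open>m\<close> smaller strata.

  Uniqueness: let \<open>f\<close> have degree \<open>m\<close> and vanish on the residual arrangement. If \<open>f\<close>
  vanishes at one end of an edge, then on the line of that edge it has \<open>d - n > m\<close> zeros, hence
  it vanishes at the other end too. The edge graph of the cone is connected, which is seen as
  in the simplex algorithm: every vertex other than a given one has a neighbour that is strictly closer to it
  (\<open>improving_neighbour\<close>). So if \<open>f\<close> vanishes at one vertex it vanishes at all of them, therefore at all
  points of the arrangement, therefore identically. Evaluation at a vertex is thus
  injective on the space of such forms, and this space has dimension at most one.

  Existence: fix a facet \<open>i0\<close> and put \<open>f\<close> equal to the sum, over the vertices
  \<open>S\<close> (as sets of facets) off \<open>i0\<close>, of \<open>\<bar>det (i0, S)\<bar>\<close> times the product of all forms outside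
  \<open>S \<union> {i0}\<close>. This is Warren's adjoint for the triangulation of the dual polytope by
  coning its boundary from the vertex \<open>i0\<close>. At a residual point lying on exactly \<open>n\<close> of the
  hyperplanes either every summand vanishes, or exactly two survive, those of the two ends of an
  edge, and the signs make them cancel (\<open>adjoint_form_exists\<close>); the count of zeros then
  takes care of all other residual points. At a vertex off \<open>i0\<close> exactly one
  summand survives, so \<open>f\<close> is not zero.

  For the translation, the linear span of a closed facet is the full complex
  hyperplane of its linear form because the facet has affine dimension \<open>n - 1\<close>. A hyperplane is
  Zariski closed, so it contains the closure of a face iff it contains the face.
\<close>

section \<open>Forms as functions\<close>

definition monomial_value :: "('k \<Rightarrow>\<^sub>0 nat) \<Rightarrow> complex ^ 'k \<Rightarrow> complex"
  where "monomial_value t v = (\<Prod>i\<in>(UNIV::'k::finite set). (v $ i) ^ Poly_Mapping.lookup t i)"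

text \<open>
  Only the values of a form matter until the very last step, and the functions given by forms are
  closed under the needed operations. The passage back to coefficients is
  \<open>mpoly_eq_0_if_eval_0\<close>.
\<close>

definition form_function :: "nat \<Rightarrow> (complex ^ 'k::finite \<Rightarrow> complex) \<Rightarrow> bool"
  where "form_function m f \<longleftrightarrow> (\<exists>F. form m F \<and> f = mpoly_eval F)"

lemma mpoly_eval_superset:
  assumes "finite T" "Poly_Mapping.keys F \<subseteq> T"
  shows "mpoly_eval F v = (\<Sum>t\<in>T. Poly_Mapping.lookup F t * monomial_value t v)"
  unfolding mpoly_eval_def monomial_value_def
  by (intro sum.mono_neutral_left) (use assms in \<open>auto simp: in_keys_iff\<close>)

lemma mpoly_eval_keys:
  "mpoly_eval F v = (\<Sum>t\<in>Poly_Mapping.keys F. Poly_Mapping.lookup F t * monomial_value t v)"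
  by (rule mpoly_eval_superset) auto

lemma mpoly_eval_add: "mpoly_eval (F + G) v = mpoly_eval F v + mpoly_eval G v"
proof -
  let ?T = "Poly_Mapping.keys F \<union> Poly_Mapping.keys G"
  have "mpoly_eval (F + G) v = (\<Sum>t\<in>?T. Poly_Mapping.lookup (F + G) t * monomial_value t v)"
    by (rule mpoly_eval_superset) (use Poly_Mapping.keys_add[of F G] in auto)
  moreover have "mpoly_eval F v = (\<Sum>t\<in>?T. Poly_Mapping.lookup F t * monomial_value t v)"
    "mpoly_eval G v = (\<Sum>t\<in>?T. Poly_Mapping.lookup G t * monomial_value t v)"
    by (rule mpoly_eval_superset; auto)+
  ultimately show ?thesis
    by (simp add: lookup_add distrib_right sum.distrib)
qed

lemma lookup_map_mult:
  "Poly_Mapping.lookup (Poly_Mapping.map ((*) c) F) t = c * Poly_Mapping.lookup (F :: 'k mpoly) t"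
  by (auto simp: Poly_Mapping.map.rep_eq when_def)

lemma keys_map_mult: "Poly_Mapping.keys (Poly_Mapping.map ((*) c) (F :: 'k mpoly)) \<subseteq> Poly_Mapping.keys F"
  by (auto simp: in_keys_iff lookup_map_mult)

lemma mpoly_eval_map_mult: "mpoly_eval (Poly_Mapping.map ((*) c) F) v = c * mpoly_eval F v"
proof -
  have "mpoly_eval (Poly_Mapping.map ((*) c) F) v
      = (\<Sum>t\<in>Poly_Mapping.keys F. Poly_Mapping.lookup (Poly_Mapping.map ((*) c) F) t * monomial_value t v)"
    by (rule mpoly_eval_superset) (auto intro: keys_map_mult[THEN subsetD])
  then show ?thesis
    by (simp add: mpoly_eval_keys lookup_map_mult sum_distrib_left mult.assoc)
qed

lemma form_add: "form m F \<Longrightarrow> form m G \<Longrightarrow> form m (F + G)"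
  unfolding form_def using Poly_Mapping.keys_add[of F G] by blast

lemma form_map_mult: "form m F \<Longrightarrow> form m (Poly_Mapping.map ((*) c) F)"
  unfolding form_def using keys_map_mult[of c F] by blast

lemma form_function_0: "form_function m (\<lambda>v. 0)"
  unfolding form_function_def
  by (rule exI[of _ 0]) (auto simp: form_def mpoly_eval_def)

lemma form_function_add:
  "form_function m f \<Longrightarrow> form_function m g \<Longrightarrow> form_function m (\<lambda>v. f v + g v)"
  unfolding form_function_def
  by (metis (no_types, lifting) ext form_add mpoly_eval_add)

lemma form_function_cmult: "form_function m f \<Longrightarrow> form_function m (\<lambda>v. c * f v)"
  unfolding form_function_def
  by (metis (no_types, lifting) ext form_map_mult mpoly_eval_map_mult)

lemma form_function_sum:
  "(\<And>x. x \<in> A \<Longrightarrow> form_function m (f x)) \<Longrightarrow> form_function m (\<lambda>v. \<Sum>x\<in>A. f x v)"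
  by (induction A rule: infinite_finite_induct) (auto intro: form_function_0 form_function_add)

lemma form_function_monomial:
  "form_function (\<Sum>i\<in>UNIV. Poly_Mapping.lookup t i) (monomial_value t)"
proof -
  have "mpoly_eval (Poly_Mapping.single t 1) = monomial_value t"
    by (rule ext) (simp add: mpoly_eval_keys)
  then show ?thesis
    unfolding form_function_def
    by (intro exI[of _ "Poly_Mapping.single t 1"]) (auto simp: form_def)
qed

lemma form_function_expand:
  assumes "form_function m f"
  obtains T c where "finite T" "\<And>t. t \<in> T \<Longrightarrow> (\<Sum>i\<in>UNIV. Poly_Mapping.lookup t i) = m"
    "f = (\<lambda>v. \<Sum>t\<in>T. c t * monomial_value t v)"
proof -
  from assms obtain F where F: "form m F" "f = mpoly_eval F"
    unfolding form_function_def by blast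
  show thesis
    by (rule that[of "Poly_Mapping.keys F" "Poly_Mapping.lookup F"])
       (use F in \<open>auto simp: form_def mpoly_eval_keys\<close>)
qed

lemma form_function_mult:
  assumes "form_function m f" "form_function l g"
  shows "form_function (m + l) (\<lambda>v. f v * g v)"
proof -
  obtain T c where T: "finite T" "\<And>t. t \<in> T \<Longrightarrow> (\<Sum>i\<in>UNIV. Poly_Mapping.lookup t i) = m"
    and f: "f = (\<lambda>v. \<Sum>t\<in>T. c t * monomial_value t v)"
    using form_function_expand[OF assms(1)] by metis
  obtain U e where U: "finite U" "\<And>t. t \<in> U \<Longrightarrow> (\<Sum>i\<in>UNIV. Poly_Mapping.lookup t i) = l"
    and g: "g = (\<lambda>v. \<Sum>t\<in>U. e t * monomial_value t v)"
    using form_function_expand[OF assms(2)] by metis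
  have mon: "monomial_value s v * monomial_value t v = monomial_value (s + t) v"
    for s t :: "'a \<Rightarrow>\<^sub>0 nat" and v
    by (simp add: monomial_value_def lookup_add power_add prod.distrib)
  have eq: "(\<lambda>v. f v * g v)
      = (\<lambda>v. \<Sum>s\<in>T. \<Sum>t\<in>U. (c s * e t) * monomial_value (s + t) v)"
    unfolding f g by (simp add: sum_product mon[symmetric] mult_ac)
  show ?thesis
    unfolding eq
  proof (intro form_function_sum form_function_cmult)
    fix s t assume "s \<in> T" "t \<in> U"
    then have "(\<Sum>i\<in>UNIV. Poly_Mapping.lookup (s + t) i) = m + l"
      using T U by (simp add: lookup_add sum.distrib)
    then show "form_function (m + l) (monomial_value (s + t))"
      using form_function_monomial by metis
  qed
qed

lemma form_function_1: "form_function 0 (\<lambda>v. 1)"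
  using form_function_monomial[of 0] by (simp add: monomial_value_def[abs_def])

lemma form_function_power: "form_function m f \<Longrightarrow> form_function (r * m) (\<lambda>v. f v ^ r)"
  by (induction r) (auto intro: form_function_1 form_function_mult)

lemma form_function_prod:
  "(\<And>x. x \<in> A \<Longrightarrow> form_function (m x) (f x)) \<Longrightarrow>
    form_function (\<Sum>x\<in>A. m x) (\<lambda>v. \<Prod>x\<in>A. f x v)"
  by (induction A rule: infinite_finite_induct) (auto intro: form_function_1 form_function_mult)

lemma form_function_linear: "form_function 1 (\<lambda>v. \<Sum>k\<in>UNIV. c k * v $ k)"
proof (intro form_function_sum form_function_cmult)
  fix k :: 'a
  have "monomial_value (Poly_Mapping.single k 1) = (\<lambda>v. v $ k)"
    by (rule ext) (simp add: monomial_value_def lookup_single when_def if_distrib[of "\<lambda>r. _ ^ r"] prod.If_cases)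
  moreover have "(\<Sum>i\<in>UNIV. Poly_Mapping.lookup (Poly_Mapping.single k (1::nat)) i) = 1"
    by (simp add: lookup_single when_def)
  ultimately show "form_function 1 (\<lambda>v. v $ k)"
    using form_function_monomial[of "Poly_Mapping.single k 1"] by simp
qed

lemma form_function_compose_matrix:
  assumes "form_function m f"
  shows "form_function m (\<lambda>v. f (M *v v))"
proof -
  obtain T c where T: "\<And>t. t \<in> T \<Longrightarrow> (\<Sum>i\<in>UNIV. Poly_Mapping.lookup t i) = m"
    and f: "f = (\<lambda>v. \<Sum>t\<in>T. c t * monomial_value t v)"
    using form_function_expand[OF assms] by metis
  have "form_function m (\<lambda>v. monomial_value t (M *v v))" if "t \<in> T" for t
  proof -
    have "form_function (\<Sum>i\<in>UNIV. Poly_Mapping.lookup t i * 1)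
        (\<lambda>v. \<Prod>i\<in>UNIV. (\<Sum>k\<in>UNIV. M $ i $ k * v $ k) ^ Poly_Mapping.lookup t i)"
      by (intro form_function_prod form_function_power form_function_linear)
    then show ?thesis
      using T[OF that] by (simp add: monomial_value_def matrix_vector_mult_def)
  qed
  then show ?thesis
    unfolding f by (intro form_function_sum form_function_cmult)
qed

lemma form_function_homogeneous:
  assumes "form_function m f"
  shows "f (c *s v) = c ^ m * f v"
proof -
  obtain T e where T: "\<And>t. t \<in> T \<Longrightarrow> (\<Sum>i\<in>UNIV. Poly_Mapping.lookup t i) = m"
    and f: "f = (\<lambda>v. \<Sum>t\<in>T. e t * monomial_value t v)"
    using form_function_expand[OF assms] by metis
  have "monomial_value t (c *s v) = c ^ m * monomial_value t v" if "t \<in> T" for t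
    by (simp add: monomial_value_def power_mult_distrib prod.distrib T[OF that, symmetric] power_sum)
  then show ?thesis
    by (simp add: f sum_distrib_left mult_ac)
qed

text \<open>
  The degree bound is what turns more than \<open>m\<close> zeros on a line into vanishing along that line.
\<close>

lemma form_function_on_line:
  assumes "form_function m f"
  obtains p where "degree p \<le> m" "\<And>s. poly p s = f (u + s *s w)"
proof -
  obtain T e where T: "finite T" "\<And>t. t \<in> T \<Longrightarrow> (\<Sum>i\<in>UNIV. Poly_Mapping.lookup t i) = m"
    and f: "f = (\<lambda>v. \<Sum>t\<in>T. e t * monomial_value t v)"
    using form_function_expand[OF assms] by metis
  define q where "q t = (\<Prod>i\<in>UNIV. [:u $ i, w $ i:] ^ Poly_Mapping.lookup t i)" for t
  have deg: "degree (q t) \<le> m" if "t \<in> T" for t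
  proof -
    have "degree (q t) \<le> (\<Sum>i\<in>UNIV. degree ([:u $ i, w $ i:] ^ Poly_Mapping.lookup t i))"
      unfolding q_def by (rule order.trans[OF degree_prod_sum_le]) (auto simp: o_def)
    also have "\<dots> \<le> (\<Sum>i\<in>UNIV. Poly_Mapping.lookup t i)"
    proof (rule sum_mono)
      fix i
      have "degree ([:u $ i, w $ i:] ^ Poly_Mapping.lookup t i)
          \<le> degree [:u $ i, w $ i:] * Poly_Mapping.lookup t i"
        by (rule degree_power_le)
      also have "\<dots> \<le> 1 * Poly_Mapping.lookup t i"
        by (intro mult_right_mono) auto
      finally show "degree ([:u $ i, w $ i:] ^ Poly_Mapping.lookup t i) \<le> Poly_Mapping.lookup t i"
        by simp
    qed
    finally show ?thesis using T that by simp
  qed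
  have val: "poly (q t) s = monomial_value t (u + s *s w)" for t s
    by (simp add: q_def monomial_value_def poly_prod mult.commute)
  show thesis
  proof (rule that[of "\<Sum>t\<in>T. smult (e t) (q t)"])
    show "degree (\<Sum>t\<in>T. smult (e t) (q t)) \<le> m"
      by (intro degree_sum_le T(1)) (use deg in \<open>auto intro: order.trans[OF degree_smult_le]\<close>)
    show "poly (\<Sum>t\<in>T. smult (e t) (q t)) s = f (u + s *s w)" for s
      by (simp add: f poly_sum val)
  qed
qed

lemma digits_unique:
  fixes x y :: "nat \<Rightarrow> nat"
  assumes "\<And>l. l < K \<Longrightarrow> x l < N" "\<And>l. l < K \<Longrightarrow> y l < N"
    and "(\<Sum>l<K. x l * N ^ l) = (\<Sum>l<K. y l * N ^ l)"
  shows "\<forall>l<K. x l = y l"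
  using assms
proof (induction K arbitrary: x y)
  case (Suc K)
  have eq: "(\<Sum>l<Suc K. z l * N ^ l) = z 0 + N * (\<Sum>l<K. z (Suc l) * N ^ l)" for z :: "nat \<Rightarrow> nat"
    by (subst sum.lessThan_Suc_shift) (simp add: sum_distrib_left mult_ac)
  have less: "x 0 < N" "y 0 < N"
    using Suc.prems by auto
  have 0: "x 0 = y 0"
    using arg_cong[OF Suc.prems(3)[unfolded eq], of "\<lambda>z. z mod N"] less by simp
  then have "(\<Sum>l<K. x (Suc l) * N ^ l) = (\<Sum>l<K. y (Suc l) * N ^ l)"
    using Suc.prems(3)[unfolded eq] less by simp
  then have "\<forall>l<K. x (Suc l) = y (Suc l)"
    by (intro Suc.IH) (use Suc.prems in auto)
  then show ?case
    using 0 by (metis less_Suc_eq_0_disj)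
qed auto

text \<open>
  Kronecker substitution: with \<open>N\<close> larger than all exponents, replacing the variables by
  \<open>s ^ N ^ 0\<close>, \<open>s ^ N ^ 1\<close>, \<open>\<dots>\<close> sends distinct monomials to distinct powers of \<open>s\<close>, because
  digits in base \<open>N\<close> are unique. The resulting univariate polynomial vanishes for all \<open>s \<noteq> 0\<close>.
\<close>

lemma mpoly_eq_0_if_eval_0:
  fixes F :: "'k::finite mpoly"
  assumes "\<And>v. v \<noteq> 0 \<Longrightarrow> mpoly_eval F v = 0"
  shows "F = 0"
proof -
  obtain h where h: "bij_betw h (UNIV::'k set) {0..<CARD('k)}"
    using ex_bij_betw_finite_nat[OF finite_class.finite_UNIV] by blast
  define N where "N = Suc (\<Sum>t\<in>Poly_Mapping.keys F. \<Sum>i\<in>UNIV. Poly_Mapping.lookup t i)"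
  have N: "Poly_Mapping.lookup t i < N" if "t \<in> Poly_Mapping.keys F" for t i
  proof -
    have "Poly_Mapping.lookup t i \<le> (\<Sum>i\<in>UNIV. Poly_Mapping.lookup t i)"
      by (rule member_le_sum) auto
    also have "\<dots> \<le> (\<Sum>t\<in>Poly_Mapping.keys F. \<Sum>i\<in>UNIV. Poly_Mapping.lookup t i)"
      using that by (intro member_le_sum) auto
    finally show ?thesis unfolding N_def by simp
  qed
  define code where "code t = (\<Sum>i\<in>UNIV. Poly_Mapping.lookup t i * N ^ h i)" for t :: "'k \<Rightarrow>\<^sub>0 nat"
  have code: "code t = (\<Sum>l<CARD('k). Poly_Mapping.lookup t (inv h l) * N ^ l)" for t
  proof -
    have "(\<Sum>i\<in>UNIV. Poly_Mapping.lookup t (inv h (h i)) * N ^ h i)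
        = (\<Sum>l<CARD('k). Poly_Mapping.lookup t (inv h l) * N ^ l)"
      by (rule sum.reindex_bij_betw) (use h in \<open>simp add: lessThan_atLeast0\<close>)
    then show ?thesis
      using h by (simp add: code_def bij_betw_def)
  qed
  have inj: "inj_on code (Poly_Mapping.keys F)"
  proof (rule inj_onI)
    fix s t assume st: "s \<in> Poly_Mapping.keys F" "t \<in> Poly_Mapping.keys F" "code s = code t"
    then have *: "\<forall>l<CARD('k). Poly_Mapping.lookup s (inv h l) = Poly_Mapping.lookup t (inv h l)"
      by (intro digits_unique[of _ _ N]) (auto simp: N code)
    have "Poly_Mapping.lookup s i = Poly_Mapping.lookup t i" for i
      using *[rule_format, of "h i"] bij_betwE[OF h] bij_betw_imp_inj_on[OF h] by simp
    then show "s = t"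
      by (intro poly_mapping_eqI)
  qed
  define p where "p = (\<Sum>t\<in>Poly_Mapping.keys F. monom (Poly_Mapping.lookup F t) (code t))"
  have "poly p s = 0" if "s \<noteq> 0" for s
  proof -
    define v :: "complex ^ 'k" where "v = (\<chi> i. s ^ (N ^ h i))"
    have "v $ i \<noteq> 0" for i
      using that by (simp add: v_def)
    then have "v \<noteq> 0" by (metis zero_index)
    moreover have "monomial_value t v = s ^ code t" for t
      by (simp add: monomial_value_def v_def code_def power_mult[symmetric] power_sum mult.commute)
    ultimately show ?thesis
      using assms[of v] by (simp add: p_def poly_sum poly_monom mpoly_eval_keys)
  qed
  then have "UNIV - {0} \<subseteq> {s. poly p s = 0}"
    by auto
  moreover have "infinite (UNIV - {0::complex})"
    by (simp add: infinite_UNIV_char_0)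
  ultimately have "p = 0"
    using poly_roots_finite finite_subset by blast
  have "Poly_Mapping.lookup F t = 0" if "t \<in> Poly_Mapping.keys F" for t
  proof -
    have "coeff p (code t) = (\<Sum>s\<in>Poly_Mapping.keys F. if s = t then Poly_Mapping.lookup F s else 0)"
      unfolding p_def coeff_sum coeff_monom
      by (intro sum.cong refl if_cong) (use inj that in \<open>auto dest: inj_onD\<close>)
    then show ?thesis
      using that \<open>p = 0\<close> by simp
  qed
  then show ?thesis
    by (metis in_keys_iff keys_eq_empty equals0I)
qed

section \<open>Real linear forms on complex vectors\<close>

definition complexify :: "real ^ 'k \<Rightarrow> complex ^ 'k::finite"
  where "complexify x = (\<chi> k. complex_of_real (x $ k))"

definition pairing :: "real ^ 'k \<Rightarrow> complex ^ 'k::finite \<Rightarrow> complex"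
  where "pairing a w = (\<Sum>k\<in>UNIV. complex_of_real (a $ k) * w $ k)"

lemma pairing_0 [simp]: "pairing a 0 = 0"
  by (simp add: pairing_def)

lemma pairing_add [simp]: "pairing a (v + w) = pairing a v + pairing a w"
  by (simp add: pairing_def distrib_left sum.distrib)

lemma pairing_scale [simp]: "pairing a (c *s w) = c * pairing a w"
  by (simp add: pairing_def sum_distrib_left mult_ac)

lemma pairing_diff [simp]: "pairing a (v - w) = pairing a v - pairing a w"
  by (simp add: pairing_def right_diff_distrib sum_subtractf)

lemma pairing_complexify [simp]: "pairing a (complexify x) = complex_of_real (a \<bullet> x)"
  by (simp add: pairing_def complexify_def inner_vec_def)

lemma Re_pairing: "Re (pairing a w) = a \<bullet> (\<chi> k. Re (w $ k))"
  by (simp add: pairing_def inner_vec_def)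

lemma complexify_eq_0_iff [simp]: "complexify x = 0 \<longleftrightarrow> x = 0"
  by (simp add: complexify_def vec_eq_iff)

lemma form_function_pairing: "form_function 1 (pairing a)"
  unfolding pairing_def[abs_def] by (rule form_function_linear)

text \<open>
  A complex subspace is not a finite union of proper subspaces: along the line from \<open>u\<close> to a
  vector where the new functional is nonzero, each functional vanishes at most once.
\<close>

lemma common_nonzero_of_functionals:
  fixes G :: "(complex ^ 'k \<Rightarrow> complex) set"
  assumes "finite G"
    and "\<And>g x y s. g \<in> G \<Longrightarrow> g (x + s *s y) = g x + s * g y"
    and "0 \<in> L" "\<And>x y s. x \<in> L \<Longrightarrow> y \<in> L \<Longrightarrow> x + s *s y \<in> L"
    and "\<And>g. g \<in> G \<Longrightarrow> \<exists>u\<in>L. g u \<noteq> 0"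
  shows "\<exists>u\<in>L. \<forall>g\<in>G. g u \<noteq> 0"
  using assms(1,2,5)
proof (induction G rule: finite_induct)
  case empty
  then show ?case using assms(3) by auto
next
  case (insert g G)
  obtain u where u: "u \<in> L" "\<forall>g\<in>G. g u \<noteq> 0"
    using insert by auto
  obtain u' where u': "u' \<in> L" "g u' \<noteq> 0"
    using insert.prems(2) by blast
  have "finite {s. h (u + s *s u') = 0}" if h: "h \<in> insert g G" for h
  proof (rule finite_subset)
    have nz: "h u \<noteq> 0 \<or> h u' \<noteq> 0"
      using h u u' by auto
    show "{s. h (u + s *s u') = 0} \<subseteq> {- (h u / h u')}"
    proof
      fix s assume "s \<in> {s. h (u + s *s u') = 0}"
      then have "s * h u' = - h u"
        using insert.prems(1)[OF h, of u s u'] by (simp add: add_eq_0_iff)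
      then show "s \<in> {- (h u / h u')}"
        using nz by (cases "h u' = 0") (auto simp: field_simps)
    qed
  qed simp
  then have "finite (\<Union>h\<in>insert g G. {s. h (u + s *s u') = 0})"
    using insert.hyps(1) by blast
  then obtain s where "s \<notin> (\<Union>h\<in>insert g G. {s. h (u + s *s u') = 0})"
    using ex_new_if_finite[OF infinite_UNIV_char_0] by blast
  then show ?case
    using assms(4)[OF u(1) u'(1), of s] by blast
qed

section \<open>Cones cut out by linear forms in general position\<close>

text \<open>
  The cone of the vectors on which all the forms \<open>\<alpha> i\<close> are nonnegative, in the vector space over
  projective space. The dimension \<open>CARD('k)\<close> is \<open>n + 1\<close>. The assumption \<open>simple\<close> speaks of
  complex points, as the simplicity of an arrangement in complex projective space does.
\<close>

locale simple_cone =
  fixes I :: "'i set" and \<alpha> :: "'i \<Rightarrow> real ^ 'k::finite"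
  assumes finite_I: "finite I"
    and card_I: "CARD('k) \<le> card I"
    and simple: "w \<noteq> 0 \<Longrightarrow> card {i\<in>I. pairing (\<alpha> i) w = 0} < CARD('k)"
    and nontrivial: "\<exists>x. x \<noteq> 0 \<and> (\<forall>i\<in>I. 0 \<le> \<alpha> i \<bullet> x)"
begin

definition zeros :: "complex ^ 'k \<Rightarrow> 'i set"
  where "zeros w = {i\<in>I. pairing (\<alpha> i) w = 0}"

definition tight :: "real ^ 'k \<Rightarrow> 'i set"
  where "tight x = {i\<in>I. \<alpha> i \<bullet> x = 0}"

definition cone :: "(real ^ 'k) set"
  where "cone = {x. \<forall>i\<in>I. 0 \<le> \<alpha> i \<bullet> x}"

text \<open>
  The sets with this property form the boundary complex of the polar dual of the cone: a set of facets
  has it iff the facets have a common point besides the apex.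
\<close>

definition meets_cone :: "'i set \<Rightarrow> bool"
  where "meets_cone S \<longleftrightarrow> (\<exists>x\<in>cone. x \<noteq> 0 \<and> S \<subseteq> tight x)"

definition vertex :: "real ^ 'k \<Rightarrow> bool"
  where "vertex x \<longleftrightarrow> x \<in> cone \<and> x \<noteq> 0 \<and> Suc (card (tight x)) = CARD('k)"

text \<open>
  All forms vanish at \<open>0\<close>, and simplicity leaves them no other common zero, so without the
  restriction to \<open>w \<noteq> 0\<close> the adjoint would have to vanish at \<open>0\<close>. In degree \<open>0\<close>, however, it
  is a nonzero constant.
\<close>

definition adjoint_form :: "(complex ^ 'k \<Rightarrow> complex) \<Rightarrow> bool"
  where "adjoint_form f \<longleftrightarrow> form_function (card I - CARD('k)) f \<and>
    (\<forall>w. w \<noteq> 0 \<longrightarrow> \<not> meets_cone (zeros w) \<longrightarrow> f w = 0)"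

lemma zeros_complexify [simp]: "zeros (complexify x) = tight x"
  by (simp add: zeros_def tight_def)

lemma zeros_subset: "zeros w \<subseteq> I" and tight_subset: "tight x \<subseteq> I"
  by (auto simp: zeros_def tight_def)

lemma finite_subset_I: "S \<subseteq> I \<Longrightarrow> finite S"
  using finite_I finite_subset by blast

lemma finite_zeros [simp]: "finite (zeros w)" and finite_tight [simp]: "finite (tight x)"
  using zeros_subset tight_subset finite_subset_I by blast+

lemma card_zeros: "w \<noteq> 0 \<Longrightarrow> card (zeros w) < CARD('k)"
  using simple by (simp add: zeros_def)

lemma card_tight: "x \<noteq> 0 \<Longrightarrow> card (tight x) < CARD('k)"
  using card_zeros[of "complexify x"] by simp

lemma eq_0_if_many_zeros: "T \<subseteq> zeros w \<Longrightarrow> CARD('k) \<le> card T \<Longrightarrow> w = 0"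
  using card_zeros[of w] card_mono[of "zeros w" T] by fastforce

lemma eq_0_if_many_tight: "T \<subseteq> tight x \<Longrightarrow> CARD('k) \<le> card T \<Longrightarrow> x = 0"
  using eq_0_if_many_zeros[of T "complexify x"] by simp

text \<open>
  General position in the form in which it is used: at most \<open>n + 1\<close> of the forms are linearly
  independent, so their values at a common vector can be prescribed freely.
\<close>

lemma interpolation:
  assumes "T \<subseteq> I" "card T \<le> CARD('k)"
  shows "\<exists>u. \<forall>i\<in>T. pairing (\<alpha> i) u = y i"
proof -
  obtain T' where T': "T \<subseteq> T'" "T' \<subseteq> I" "card T' = CARD('k)"
    using exists_subset_between[OF assms(2) card_I assms(1) finite_I] by blast
  obtain g where g: "bij_betw g (UNIV::'k set) T'"
    using finite_same_card_bij[of "UNIV::'k set" T'] T' finite_subset_I by auto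
  define A :: "complex ^ 'k ^ 'k" where "A = (\<chi> r. complexify (\<alpha> (g r)))"
  have A: "(A *v w) $ r = pairing (\<alpha> (g r)) w" for w r
    by (simp add: A_def matrix_vector_mult_def pairing_def complexify_def)
  have "w = 0" if "A *v w = 0" for w
  proof (rule eq_0_if_many_zeros)
    show "T' \<subseteq> zeros w"
    proof
      fix i assume "i \<in> T'"
      then obtain r where "i = g r"
        using g by (auto simp: bij_betw_def)
      then show "i \<in> zeros w"
        using A[of w r] that T' \<open>i \<in> T'\<close> by (auto simp: zeros_def)
    qed
  qed (use T' in simp)
  then have "\<exists>B. B ** A = mat 1"
    by (simp add: matrix_left_invertible_ker)
  then have "surj ((*v) A)"
    using matrix_left_right_inverse matrix_right_invertible_surjective by metis
  then obtain u where u: "A *v u = (\<chi> r. y (g r))"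
    by (metis surjD)
  have "pairing (\<alpha> i) u = y i" if i: "i \<in> T" for i
  proof -
    obtain r where "i = g r"
      using bij_betw_imp_surj_on[OF g] T'(1) i by blast
    then show ?thesis
      using A[of u r] u by simp
  qed
  then show ?thesis by blast
qed

lemma real_interpolation:
  assumes "T \<subseteq> I" "card T \<le> CARD('k)"
  shows "\<exists>u. \<forall>i\<in>T. \<alpha> i \<bullet> u = y i"
proof -
  obtain u where "\<forall>i\<in>T. pairing (\<alpha> i) u = complex_of_real (y i)"
    using interpolation[OF assms, of "\<lambda>i. complex_of_real (y i)"] by blast
  then have "\<forall>i\<in>T. \<alpha> i \<bullet> (\<chi> k. Re (u $ k)) = y i"
    by (metis Re_complex_of_real Re_pairing)
  then show ?thesis by blast
qed

section \<open>Forms vanishing on the strata of the arrangement\<close>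

lemma stratum_nonzero:
  assumes "T \<subseteq> I" "card T < CARD('k)"
  shows "\<exists>w. w \<noteq> 0 \<and> T \<subseteq> zeros w"
proof -
  have "T \<noteq> I"
    using assms card_I by auto
  then obtain k where k: "k \<in> I" "k \<notin> T"
    using assms by blast
  obtain w where w: "\<forall>i\<in>insert k T. pairing (\<alpha> i) w = (if i = k then 1 else 0)"
    using interpolation[of "insert k T" "\<lambda>i. if i = k then 1 else 0"] k assms
      finite_subset_I[OF assms(1)] by auto
  then have "w \<noteq> 0"
    by auto
  moreover have "T \<subseteq> zeros w"
    using w k assms by (auto simp: zeros_def)
  ultimately show ?thesis by blast
qed

text \<open>
  A generic line through \<open>w\<close> inside the stratum of \<open>S\<close> meets the hyperplanes of \<open>J\<close> in
  pairwise different points, which are more than \<open>m\<close> zeros of \<open>f\<close>. Allowing \<open>w\<close> to lie on more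
  hyperplanes than those of \<open>S\<close> matters for the neighbouring vertices below, where \<open>w\<close> is a vertex
  and \<open>S\<close> cuts out an edge through it.
\<close>

lemma form_vanishes_on_stratum:
  assumes f: "form_function m f"
    and S: "S \<subseteq> zeros w" "card S + 2 \<le> CARD('k)" and w: "w \<noteq> 0"
    and J: "J \<subseteq> I - zeros w" "m < card J"
    and vanish: "\<And>j w'. j \<in> J \<Longrightarrow> w' \<noteq> 0 \<Longrightarrow> insert j S \<subseteq> zeros w' \<Longrightarrow> f w' = 0"
  shows "f w = 0"
proof -
  have SI: "S \<subseteq> I" and JI: "J \<subseteq> I"
    using S(1) J(1) zeros_subset[of w] by auto
  then have finS: "finite S" and finJ: "finite J"
    using finite_subset_I by auto
  have JS: "j \<notin> S" if "j \<in> J" for j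
    using that S J by blast
  have vanish': "f w' = 0" if j: "j \<in> J" "insert j S \<subseteq> zeros w'" for j w'
  proof (cases "w' = 0")
    case True
    obtain v where "v \<noteq> 0" "insert j S \<subseteq> zeros v"
      using stratum_nonzero[of "insert j S"] j JI SI S(2) finS JS[OF j(1)] by auto
    then have "f v = 0" using vanish j by blast
    then show ?thesis
      using form_function_homogeneous[OF f, of 0 v] True by simp
  qed (use vanish j in blast)
  \<comment> \<open>On the line of the points \<open>w + s u\<close>, the form \<open>j\<close> vanishes at \<open>s = - 1 / b j u\<close>.\<close>
  define b where "b j u = pairing (\<alpha> j) u / pairing (\<alpha> j) w" for j u
  have aw: "pairing (\<alpha> j) w \<noteq> 0" if "j \<in> J" for j
    using that J by (auto simp: zeros_def)
  define L where "L = {u. S \<subseteq> zeros u}"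
  have L: "u \<in> L \<longleftrightarrow> (\<forall>i\<in>S. pairing (\<alpha> i) u = 0)" for u
    using SI by (auto simp: L_def zeros_def)
  define G where "G = b ` J \<union> (\<lambda>(j, k) u. b j u - b k u) ` {(j, k) \<in> J \<times> J. j \<noteq> k}"
  have "\<exists>u\<in>L. \<forall>g\<in>G. g u \<noteq> 0"
  proof (rule common_nonzero_of_functionals)
    have "finite {(j, k) \<in> J \<times> J. j \<noteq> k}"
      by (rule finite_subset[of _ "J \<times> J"]) (use finJ in auto)
    then show "finite G"
      using finJ by (auto simp: G_def)
    show "g (x + s *s y) = g x + s * g y" if "g \<in> G" for g x y s
      using that by (auto simp: G_def b_def add_divide_distrib diff_divide_distrib algebra_simps)
    show "0 \<in> L" "\<And>x y s. x \<in> L \<Longrightarrow> y \<in> L \<Longrightarrow> x + s *s y \<in> L"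
      by (auto simp: L)
    show "\<exists>u\<in>L. g u \<noteq> 0" if g: "g \<in> G" for g
    proof -
      have "\<exists>u\<in>L. b j u \<noteq> 0 \<and> (k = j \<or> b j u - b k u \<noteq> 0)" if jk: "j \<in> J" "k \<in> J" for j k
      proof -
        have "card (insert j (insert k S)) \<le> CARD('k)"
          using S(2) by (simp add: card_insert_if finS)
        then obtain u where u: "\<forall>i\<in>insert j (insert k S). pairing (\<alpha> i) u = (if i = j then 1 else 0)"
          using interpolation[of "insert j (insert k S)" "\<lambda>i. if i = j then 1 else 0"] jk JI SI by auto
        then have "u \<in> L"
          using JS jk by (auto simp: L)
        then show ?thesis
          using u jk aw by (intro bexI[of _ u]) (auto simp: b_def)
      qed
      then show ?thesis
        using g unfolding G_def by fastforce
    qed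
  qed
  then obtain u where u: "u \<in> L" "\<forall>g\<in>G. g u \<noteq> 0"
    by blast
  have b0: "b j u \<noteq> 0" if "j \<in> J" for j
    using u(2) that by (auto simp: G_def)
  have inj: "inj_on (\<lambda>j. - 1 / b j u) J"
  proof (rule inj_onI, rule ccontr)
    fix j k assume jk: "j \<in> J" "k \<in> J" "- 1 / b j u = - 1 / b k u" "j \<noteq> k"
    then have "(\<lambda>u. b j u - b k u) \<in> G"
      unfolding G_def by (intro UnI2 image_eqI[of _ _ "(j, k)"]) auto
    then have "b j u \<noteq> b k u"
      using u(2) by fastforce
    then show False
      using jk b0[of j] b0[of k] by (simp add: field_simps)
  qed
  obtain p where p: "degree p \<le> m" "\<And>s. poly p s = f (w + s *s u)"
    using form_function_on_line[OF f] by metis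
  have root: "poly p (- 1 / b j u) = 0" if j: "j \<in> J" for j
  proof -
    have "pairing (\<alpha> j) (w + (- 1 / b j u) *s u) = 0"
      using aw[OF j] b0[OF j] by (simp add: b_def)
    moreover have "\<forall>i\<in>S. pairing (\<alpha> i) (w + (- 1 / b j u) *s u) = 0"
      using u(1) S(1) by (auto simp: L zeros_def)
    ultimately have "insert j S \<subseteq> zeros (w + (- 1 / b j u) *s u)"
      using j JI SI by (auto simp: zeros_def)
    then show ?thesis
      using vanish' j p(2) by simp
  qed
  have "p = 0"
  proof (rule ccontr)
    assume "p \<noteq> 0"
    have "card J = card ((\<lambda>j. - 1 / b j u) ` J)"
      using inj by (simp add: card_image)
    also have "\<dots> \<le> card {s. poly p s = 0}"
      using root poly_roots_finite[OF \<open>p \<noteq> 0\<close>] by (intro card_mono) auto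
    also have "\<dots> \<le> degree p"
      by (rule card_poly_roots_bound[OF \<open>p \<noteq> 0\<close>])
    finally show False using p J by simp
  qed
  then show ?thesis using p(2)[of 0] by simp
qed

text \<open>
  Downward induction on the number of hyperplanes through \<open>w\<close>: the stratum of \<open>w\<close> is met by
  \<open>card I - card (zeros w) > m\<close> further hyperplanes, in smaller strata.
\<close>

lemma form_vanishes_from_points:
  assumes f: "form_function m f" and m: "m + CARD('k) \<le> card I"
    and points: "\<And>w. w \<noteq> 0 \<Longrightarrow> S \<subseteq> zeros w \<Longrightarrow> Suc (card (zeros w)) = CARD('k) \<Longrightarrow> f w = 0"
    and w: "w \<noteq> 0" "S \<subseteq> zeros w"
  shows "f w = 0"
  using w
proof (induction "CARD('k) - card (zeros w)" arbitrary: w rule: less_induct)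
  case less
  show ?case
  proof (cases "Suc (card (zeros w)) = CARD('k)")
    case False
    have c: "card (zeros w) + 2 \<le> CARD('k)"
      using False card_zeros[OF less.prems(1)] by linarith
    show ?thesis
    proof (rule form_vanishes_on_stratum[OF f order.refl c less.prems(1) order.refl])
      show "m < card (I - zeros w)"
        using m c card_Diff_subset[OF finite_zeros zeros_subset, of w] by simp
      fix j w' assume j: "j \<in> I - zeros w" "w' \<noteq> 0" "insert j (zeros w) \<subseteq> zeros w'"
      then have "card (insert j (zeros w)) \<le> card (zeros w')"
        by (intro card_mono) auto
      then have "card (zeros w) < card (zeros w')"
        using j by simp
      then show "f w' = 0"
        using card_zeros[OF j(2)] c j less.prems by (intro less.hyps) auto
    qed
  qed (use points less.prems in blast)
qed

section \<open>Vertices and edges of the cone\<close>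

lemma cone_nonneg: "x \<in> cone \<Longrightarrow> i \<in> I \<Longrightarrow> 0 \<le> \<alpha> i \<bullet> x"
  by (simp add: cone_def)

lemma cone_pos: "x \<in> cone \<Longrightarrow> i \<in> I \<Longrightarrow> i \<notin> tight x \<Longrightarrow> 0 < \<alpha> i \<bullet> x"
  using cone_nonneg[of x i] by (auto simp: tight_def)

lemma tightD: "i \<in> tight x \<Longrightarrow> \<alpha> i \<bullet> x = 0"
  by (simp add: tight_def)

lemma card_I_minus_tight: "x \<noteq> 0 \<Longrightarrow> I - tight x \<noteq> {}"
  using card_tight[of x] card_I card_mono[of "tight x" I] by fastforce

text \<open>
  The vector \<open>u - t x\<close> lies in the cone when \<open>t\<close> is sufficiently negative, and at the largest
  such \<open>t\<close> a new form becomes tight. This is the pivoting step of the simplex algorithm.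
\<close>

lemma ratio_test:
  assumes x: "x \<in> cone" "x \<noteq> 0" and u: "\<And>i. i \<in> tight x \<Longrightarrow> 0 \<le> \<alpha> i \<bullet> u"
  obtains t j where "j \<in> I - tight x" "\<alpha> j \<bullet> (u - t *\<^sub>R x) = 0" "u - t *\<^sub>R x \<in> cone"
    "\<And>i. i \<in> I - tight x \<Longrightarrow> t \<le> (\<alpha> i \<bullet> u) / (\<alpha> i \<bullet> x)"
proof -
  define r where "r i = (\<alpha> i \<bullet> u) / (\<alpha> i \<bullet> x)" for i
  have "finite (I - tight x)"
    using finite_I by simp
  then obtain j where j: "j \<in> I - tight x" "\<And>i. i \<in> I - tight x \<Longrightarrow> r j \<le> r i"
    using card_I_minus_tight[OF x(2)] by (metis arg_min_if_finite(1) arg_min_least)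
  have "0 \<le> \<alpha> i \<bullet> (u - r j *\<^sub>R x)" if i: "i \<in> I" for i
  proof (cases "i \<in> tight x")
    case True
    then show ?thesis using u tightD[OF True] by (simp add: inner_diff_right)
  next
    case False
    then have "r j * (\<alpha> i \<bullet> x) \<le> \<alpha> i \<bullet> u"
      using cone_pos[OF x(1) i] j(2)[of i] i by (simp add: r_def pos_le_divide_eq)
    then show ?thesis by (simp add: inner_diff_right)
  qed
  moreover have "\<alpha> j \<bullet> (u - r j *\<^sub>R x) = 0"
    using cone_pos[OF x(1), of j] j(1) by (simp add: r_def inner_diff_right)
  ultimately show thesis
    using j by (intro that[of j "r j"]) (auto simp: cone_def r_def)
qed

text \<open>
  A point of the cone with as many tight forms as possible: if it were not a vertex, the ratio test in a
  direction that keeps the tight forms tight would give a nonzero point with one more.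
\<close>

lemma vertex_exists: "\<exists>x. vertex x"
proof -
  obtain x0 where x0: "x0 \<in> cone" "x0 \<noteq> 0"
    using nontrivial by (auto simp: cone_def)
  obtain x where x: "x \<in> cone" "x \<noteq> 0"
    and max: "\<And>y. y \<in> cone \<Longrightarrow> y \<noteq> 0 \<Longrightarrow> card (tight y) \<le> card (tight x)"
    using ex_has_greatest_nat[of "\<lambda>x. x \<in> cone \<and> x \<noteq> 0" x0 "\<lambda>x. card (tight x)" "CARD('k)"]
      x0 card_tight by blast
  have "Suc (card (tight x)) = CARD('k)"
  proof (rule ccontr)
    assume "Suc (card (tight x)) \<noteq> CARD('k)"
    then have c: "card (tight x) + 2 \<le> CARD('k)"
      using card_tight[OF x(2)] by linarith
    have "2 \<le> card (I - tight x)"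
      using c card_I card_Diff_subset[OF finite_tight tight_subset, of x] by simp
    then have "\<not> card (I - tight x) \<le> Suc 0"
      by simp
    then obtain j k where jk: "j \<in> I - tight x" "k \<in> I - tight x" "j \<noteq> k"
      using card_le_Suc0_iff_eq[of "I - tight x"] finite_I by auto
    have "card (insert j (insert k (tight x))) \<le> CARD('k)"
      using jk c by simp
    \<comment> \<open>The values at \<open>j\<close> and \<open>k\<close> are chosen so that the new point is not \<open>0\<close>: the value \<open>0\<close> at \<open>k\<close>
      forces \<open>t \<le> 0\<close>, and then the form \<open>j\<close> stays positive.\<close>
    then obtain u where u: "\<forall>i\<in>insert j (insert k (tight x)). \<alpha> i \<bullet> u = (if i = j then 1 else 0)"
      using real_interpolation[of "insert j (insert k (tight x))" "\<lambda>i. if i = j then 1 else 0"]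
        jk tight_subset[of x] by auto
    have u0: "\<alpha> i \<bullet> u = 0" if "i \<in> tight x" for i
      using u that jk by auto
    obtain t l where tl: "l \<in> I - tight x" "\<alpha> l \<bullet> (u - t *\<^sub>R x) = 0" "u - t *\<^sub>R x \<in> cone"
      "\<And>i. i \<in> I - tight x \<Longrightarrow> t \<le> (\<alpha> i \<bullet> u) / (\<alpha> i \<bullet> x)"
      using ratio_test[OF x, of u] u0 by (metis order_refl)
    have "t \<le> 0"
      using tl(4)[OF jk(2)] u jk by simp
    then have "t * (\<alpha> j \<bullet> x) \<le> 0"
      using cone_pos[OF x(1), of j] jk by (intro mult_nonpos_nonneg) auto
    then have "0 < \<alpha> j \<bullet> (u - t *\<^sub>R x)"
      using u by (simp add: inner_diff_right)
    then have nz: "u - t *\<^sub>R x \<noteq> 0"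
      by (metis inner_zero_right less_irrefl)
    have "insert l (tight x) \<subseteq> tight (u - t *\<^sub>R x)"
      using tl u0 by (auto simp: tight_def inner_diff_right)
    then have "card (insert l (tight x)) \<le> card (tight (u - t *\<^sub>R x))"
      by (intro card_mono) auto
    then show False
      using max[OF tl(3) nz] tl(1) by simp
  qed
  then show ?thesis using x by (auto simp: vertex_def)
qed

lemma vertex_if_tight:
  assumes "x \<in> cone" "x \<noteq> 0" "S \<subseteq> tight x" "Suc (card S) = CARD('k)"
  shows "vertex x" "tight x = S"
proof -
  have "card (tight x) \<le> card S"
    using card_tight[OF assms(2)] assms(4) by simp
  then show "tight x = S"
    using card_seteq[OF finite_tight assms(3)] by simp
  then show "vertex x" using assms by (simp add: vertex_def)
qed

text \<open>
  The ratio test in a direction that releases only the constraint \<open>j\<close>.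
\<close>

lemma edge_other_end:
  assumes x: "vertex x" and j: "j \<in> tight x"
  obtains y k where "vertex y" "k \<in> I - tight x" "tight y = insert k (tight x - {j})"
proof -
  obtain u where u: "\<forall>i\<in>tight x. \<alpha> i \<bullet> u = (if i = j then 1 else 0)"
    using real_interpolation[OF tight_subset, of x "\<lambda>i. if i = j then 1 else 0"] x
    by (auto simp: vertex_def)
  have x': "x \<in> cone" "x \<noteq> 0" using x by (auto simp: vertex_def)
  obtain t k where k: "k \<in> I - tight x" "\<alpha> k \<bullet> (u - t *\<^sub>R x) = 0" "u - t *\<^sub>R x \<in> cone"
    using ratio_test[OF x', of u] u by (metis order_refl zero_le_one)
  let ?y = "u - t *\<^sub>R x"
  have "\<alpha> j \<bullet> ?y = 1"
    using u j tightD[OF j] by (simp add: inner_diff_right)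
  then have nz: "?y \<noteq> 0" by (metis inner_zero_right zero_neq_one)
  have sub: "insert k (tight x - {j}) \<subseteq> tight ?y"
    using u k by (auto simp: tight_def inner_diff_right)
  have "card (tight x) > 0"
    using j by (auto simp: card_gt_0_iff)
  then have "Suc (card (insert k (tight x - {j}))) = CARD('k)"
    using x j k(1) by (simp add: vertex_def)
  from vertex_if_tight[OF k(3) nz sub this] show thesis
    using k(1) that by blast
qed

text \<open>
  Both sides agree under \<open>j\<close>, \<open>k\<close> and the forms that vanish on the edge, which are \<open>n + 1\<close> forms.
\<close>

lemma edge_ends_span:
  assumes x: "vertex x" and y: "vertex y" and j: "j \<in> tight x" and k: "k \<in> I - tight x"
    and ty: "tight y = insert k (tight x - {j})" and z: "tight x - {j} \<subseteq> tight z"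
  shows "z = ((\<alpha> k \<bullet> z) / (\<alpha> k \<bullet> x)) *\<^sub>R x + ((\<alpha> j \<bullet> z) / (\<alpha> j \<bullet> y)) *\<^sub>R y" (is "z = ?z")
    and "0 < \<alpha> k \<bullet> x" "0 < \<alpha> j \<bullet> y"
proof -
  have jI: "j \<in> I" using j tight_subset by blast
  show kx: "0 < \<alpha> k \<bullet> x"
    using cone_pos[of x k] x k by (auto simp: vertex_def)
  show jy: "0 < \<alpha> j \<bullet> y"
    using cone_pos[of y j] y j k ty jI by (auto simp: vertex_def)
  have "insert k (tight x) \<subseteq> tight (z - ?z)"
  proof
    fix i assume i: "i \<in> insert k (tight x)"
    consider "i = k" | "i = j" | "i \<in> tight x - {j}" using i by blast
    then have "\<alpha> i \<bullet> (z - ?z) = 0"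
    proof cases
      case 1
      then show ?thesis using kx ty tightD[of k y] by (simp add: inner_diff_right inner_add_right)
    next
      case 2
      then show ?thesis using jy tightD[OF j] by (simp add: inner_diff_right inner_add_right)
    next
      case 3
      then have "i \<in> tight x" "i \<in> tight y" "i \<in> tight z" using ty z by auto
      then show ?thesis by (simp add: inner_diff_right inner_add_right tightD)
    qed
    then show "i \<in> tight (z - ?z)"
      using i k tight_subset[of x] by (auto simp: tight_def)
  qed
  then have "z - ?z = 0"
    by (rule eq_0_if_many_tight) (use x k in \<open>simp add: vertex_def\<close>)
  then show "z = ?z" by simp
qed

text \<open>
  A point of the cone on the line of an edge is a nonnegative combination of the two ends, so
  any further form vanishing at it would vanish at an end.
\<close>

lemma edge_no_third_point:
  assumes x: "vertex x" and y: "vertex y" and j: "j \<in> tight x" and k: "k \<in> I - tight x"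
    and ty: "tight y = insert k (tight x - {j})"
    and z: "z \<in> cone" "z \<noteq> 0" "insert l (tight x - {j}) \<subseteq> tight z" "l \<notin> tight x - {j}"
  shows "l = j \<or> l = k"
proof (rule ccontr)
  assume l: "\<not> (l = j \<or> l = k)"
  have "tight x - {j} \<subseteq> tight z" using z by simp
  note span = edge_ends_span[OF x y j k ty this]
  have jI: "j \<in> I" and lI: "l \<in> I" using j z(3) tight_subset by blast+
  have lx: "0 < \<alpha> l \<bullet> x" and ly: "0 < \<alpha> l \<bullet> y"
    using cone_pos[of x l] cone_pos[of y l] x y l z(4) ty lI by (auto simp: vertex_def)
  define a where "a = (\<alpha> k \<bullet> z) / (\<alpha> k \<bullet> x)"
  define b where "b = (\<alpha> j \<bullet> z) / (\<alpha> j \<bullet> y)"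
  have ab: "0 \<le> a" "0 \<le> b"
    using span cone_nonneg[OF z(1)] jI k by (auto simp: a_def b_def)
  have zab: "z = a *\<^sub>R x + b *\<^sub>R y"
    using span(1) by (simp add: a_def b_def)
  have "0 = a * (\<alpha> l \<bullet> x) + b * (\<alpha> l \<bullet> y)"
    using z(3) tightD[of l z] zab by (simp add: inner_add_right)
  then have "a = 0" "b = 0"
    using ab lx ly by (auto simp: add_nonneg_eq_0_iff dest!: sym)
  then show False using zab z(2) by simp
qed

lemma proportional_to_vertex:
  assumes x: "vertex x" and w: "tight x \<subseteq> zeros w"
  shows "\<exists>c. w = c *s complexify x"
proof -
  have "x \<noteq> 0" using x by (simp add: vertex_def)
  then obtain i where i: "i \<in> I" "i \<notin> tight x"
    using card_I_minus_tight by blast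
  define c where "c = pairing (\<alpha> i) w / of_real (\<alpha> i \<bullet> x)"
  have "insert i (tight x) \<subseteq> zeros (w - c *s complexify x)"
    using i w by (auto simp: zeros_def tight_def c_def)
  then have "w - c *s complexify x = 0"
    by (rule eq_0_if_many_zeros) (use x i in \<open>simp add: vertex_def\<close>)
  then show ?thesis by auto
qed

lemma vertex_same_tight:
  assumes x: "vertex x" and y: "vertex y" and eq: "tight x = tight y"
  shows "\<exists>c>0. y = c *\<^sub>R x"
proof -
  have "x \<noteq> 0" using x by (simp add: vertex_def)
  then obtain i where i: "i \<in> I" "i \<notin> tight x"
    using card_I_minus_tight by blast
  have pos: "0 < \<alpha> i \<bullet> x" "0 < \<alpha> i \<bullet> y"
    using cone_pos[of x i] cone_pos[of y i] i eq x y by (auto simp: vertex_def)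
  define c where "c = (\<alpha> i \<bullet> y) / (\<alpha> i \<bullet> x)"
  have "\<alpha> l \<bullet> (y - c *\<^sub>R x) = 0" if "l \<in> insert i (tight x)" for l
  proof (cases "l = i")
    case True
    then show ?thesis using pos by (simp add: c_def inner_diff_right)
  next
    case False
    then have "l \<in> tight x" "l \<in> tight y" using that eq by auto
    then show ?thesis by (simp add: inner_diff_right tightD)
  qed
  then have "insert i (tight x) \<subseteq> tight (y - c *\<^sub>R x)"
    using i tight_subset[of x] by (auto simp: tight_def)
  then have "y - c *\<^sub>R x = 0"
    by (rule eq_0_if_many_tight) (use x i in \<open>simp add: vertex_def\<close>)
  then show ?thesis
    using pos by (intro exI[of _ c]) (auto simp: c_def)
qed

text \<open>
  The functional \<open>c\<close> is nonnegative on the cone and vanishes only on the ray of \<open>z\<close>, and \<open>h\<close>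
  normalizes it to a function on rays. The vector \<open>z\<close> is a multiple of \<open>x\<close> plus a nonnegative
  combination of the neighbours of \<open>x\<close>. The functional \<open>\<phi>\<close>, which compares the value of a
  point with that of \<open>x\<close>, vanishes at \<open>x\<close> and is negative at \<open>z\<close>, so it is negative at some
  neighbour.
\<close>

lemma improving_neighbour:
  assumes x: "vertex x" and z: "vertex z" and ne: "tight x \<noteq> tight z"
  defines "c \<equiv> \<Sum>i\<in>tight z. \<alpha> i" and "h \<equiv> \<Sum>i\<in>I. \<alpha> i"
  shows "\<exists>y j k. vertex y \<and> j \<in> tight x \<and> k \<in> I - tight x \<and> tight y = insert k (tight x - {j}) \<and>
    (c \<bullet> y) / (h \<bullet> y) < (c \<bullet> x) / (h \<bullet> x)"
proof -
  have h_pos: "0 < h \<bullet> v" if v: "vertex v" for v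
  proof -
    have "v \<noteq> 0" "v \<in> cone" using v by (auto simp: vertex_def)
    then obtain i where i: "i \<in> I" "i \<notin> tight v"
      using card_I_minus_tight by blast
    then show ?thesis
      unfolding h_def inner_sum_left
      by (intro sum_pos2[OF finite_I]) (use \<open>v \<in> cone\<close> cone_pos cone_nonneg in auto)
  qed
  have cx: "0 < c \<bullet> x"
  proof -
    have "\<not> tight z \<subseteq> tight x"
      using ne x z card_seteq[OF finite_tight, of "tight z" x] by (auto simp: vertex_def)
    then obtain i where i: "i \<in> tight z" "i \<notin> tight x" by blast
    then show ?thesis
      unfolding c_def inner_sum_left
      by (intro sum_pos2[OF finite_tight])
         (use x tight_subset[of z] cone_pos cone_nonneg in \<open>auto simp: vertex_def\<close>)
  qed
  have cz: "c \<bullet> z = 0"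
    unfolding c_def inner_sum_left by (intro sum.neutral) (simp add: tightD)
  define \<phi> where "\<phi> = c - ((c \<bullet> x) / (h \<bullet> x)) *\<^sub>R h"
  have \<phi>x: "\<phi> \<bullet> x = 0"
    using h_pos[OF x] by (simp add: \<phi>_def inner_diff_left)
  have "\<phi> \<bullet> z < 0"
    using h_pos[OF x] h_pos[OF z] cx by (simp add: \<phi>_def inner_diff_left cz)
  have "\<forall>j\<in>tight x. \<exists>y k. vertex y \<and> k \<in> I - tight x \<and> tight y = insert k (tight x - {j})"
    using edge_other_end[OF x] by metis
  then obtain Y K where Y: "\<And>j. j \<in> tight x \<Longrightarrow>
      vertex (Y j) \<and> K j \<in> I - tight x \<and> tight (Y j) = insert (K j) (tight x - {j})"
    by metis
  have Ypos: "0 < \<alpha> j \<bullet> Y j" if "j \<in> tight x" for j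
  proof -
    have "j \<notin> tight (Y j)" "Y j \<in> cone" "j \<in> I"
      using Y[OF that] that tight_subset[of x] by (auto simp: vertex_def)
    then show ?thesis using cone_pos by blast
  qed
  define b where "b j = (\<alpha> j \<bullet> z) / (\<alpha> j \<bullet> Y j)" for j
  define v where "v = z - (\<Sum>j\<in>tight x. b j *\<^sub>R Y j)"
  have "\<alpha> i \<bullet> v = 0" if i: "i \<in> tight x" for i
  proof -
    have "\<alpha> i \<bullet> (\<Sum>j\<in>tight x. b j *\<^sub>R Y j) = (\<Sum>j\<in>tight x. if j = i then \<alpha> i \<bullet> z else 0)"
      unfolding inner_sum_right
    proof (intro sum.cong refl)
      fix j assume j: "j \<in> tight x"
      show "\<alpha> i \<bullet> (b j *\<^sub>R Y j) = (if j = i then \<alpha> i \<bullet> z else 0)"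
      proof (cases "j = i")
        case True
        then show ?thesis using Ypos[OF j] by (simp add: b_def)
      next
        case False
        then have "i \<in> tight (Y j)" using Y[OF j] i by auto
        then show ?thesis using False by (simp add: tightD)
      qed
    qed
    then show ?thesis using i by (simp add: v_def inner_diff_right)
  qed
  then have "tight x \<subseteq> zeros (complexify v)"
    using tight_subset[of x] by (auto simp: zeros_def)
  from proportional_to_vertex[OF x this] obtain a where a: "complexify v = a *s complexify x" by blast
  have "complex_of_real (\<phi> \<bullet> v) = a * of_real (\<phi> \<bullet> x)"
    using arg_cong[OF a, of "pairing \<phi>"] by simp
  then have "\<phi> \<bullet> v = 0"
    using \<phi>x by simp
  then have "\<phi> \<bullet> z = (\<Sum>j\<in>tight x. b j * (\<phi> \<bullet> Y j))"
    by (simp add: v_def inner_diff_right inner_sum_right)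
  with \<open>\<phi> \<bullet> z < 0\<close> have "\<not> (\<forall>j\<in>tight x. 0 \<le> b j * (\<phi> \<bullet> Y j))"
    using sum_nonneg[of "tight x" "\<lambda>j. b j * (\<phi> \<bullet> Y j)"] by auto
  then obtain j where j: "j \<in> tight x" "b j * (\<phi> \<bullet> Y j) < 0"
    by (auto simp: not_le)
  have "0 \<le> b j"
    using Ypos[OF j(1)] cone_nonneg[of z j] z j(1) tight_subset[of x]
    by (auto simp: b_def vertex_def intro!: divide_nonneg_pos)
  then have "\<phi> \<bullet> Y j < 0"
    using j(2) by (simp add: mult_less_0_iff)
  then have "c \<bullet> Y j < ((c \<bullet> x) / (h \<bullet> x)) * (h \<bullet> Y j)"
    by (simp add: \<phi>_def inner_diff_left)
  then have "(c \<bullet> Y j) / (h \<bullet> Y j) < (c \<bullet> x) / (h \<bullet> x)"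
    using h_pos[of "Y j"] Y[OF j(1)] by (simp add: pos_divide_less_eq)
  then show ?thesis
    using Y[OF j(1)] j(1) by blast
qed

section \<open>Uniqueness of the adjoint form\<close>

text \<open>
  On the line of the edge from \<open>x\<close> to \<open>y\<close> the points of the arrangement other than the two
  ends are residual. Together with \<open>y\<close> they are \<open>card (I - tight x)\<close> zeros, one more than the
  degree.
\<close>

lemma adjoint_form_vanishes_at_neighbour:
  assumes f: "adjoint_form f" and x: "vertex x" and y: "vertex y"
    and j: "j \<in> tight x" and k: "k \<in> I - tight x" and ty: "tight y = insert k (tight x - {j})"
    and fy: "f (complexify y) = 0"
  shows "f (complexify x) = 0"
proof (rule form_vanishes_on_stratum[where S = "tight x - {j}" and J = "I - tight x" and m = "card I - CARD('k)"])
  show ff: "form_function (card I - CARD('k)) f"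
    using f by (simp add: adjoint_form_def)
  show "tight x - {j} \<subseteq> zeros (complexify x)" "complexify x \<noteq> 0"
      "I - tight x \<subseteq> I - zeros (complexify x)"
    using x by (auto simp: vertex_def)
  have "0 < card (tight x)" using j by (auto simp: card_gt_0_iff)
  then show "card (tight x - {j}) + 2 \<le> CARD('k)"
    using j x by (simp add: vertex_def)
  show "card I - CARD('k) < card (I - tight x)"
    using card_Diff_subset[OF finite_tight tight_subset, of x] card_I x by (auto simp: vertex_def)
  fix l w assume l: "l \<in> I - tight x" "w \<noteq> 0" "insert l (tight x - {j}) \<subseteq> zeros w"
  show "f w = 0"
  proof (cases "l = k")
    case True
    then obtain c where "w = c *s complexify y"
      using proportional_to_vertex[OF y, of w] ty l by auto
    then show ?thesis
      using form_function_homogeneous[OF ff] fy by simp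
  next
    case False
    have "\<not> meets_cone (zeros w)"
    proof
      assume "meets_cone (zeros w)"
      then obtain z where "z \<in> cone" "z \<noteq> 0" "insert l (tight x - {j}) \<subseteq> tight z"
        using l by (auto simp: meets_cone_def)
      from edge_no_third_point[OF x y j k ty this] show False
        using l False j by auto
    qed
    then show ?thesis using f l by (simp add: adjoint_form_def)
  qed
qed

text \<open>
  Among the vertices where \<open>f\<close> does not vanish, one closest to \<open>z\<close> would have a strictly closer
  neighbour where \<open>f\<close> vanishes.
\<close>

lemma adjoint_form_eq_0_if_vanishes_at_vertex:
  assumes f: "adjoint_form f" and z: "vertex z" "f (complexify z) = 0" and w: "w \<noteq> 0"
  shows "f w = 0"
proof -
  have ff: "form_function (card I - CARD('k)) f"
    using f by (simp add: adjoint_form_def)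
  define c h where "c = (\<Sum>i\<in>tight z. \<alpha> i)" and "h = (\<Sum>i\<in>I. \<alpha> i)"
  define g where "g x = (c \<bullet> x) / (h \<bullet> x)" for x
  define B where "B = {x. vertex x \<and> f (complexify x) \<noteq> 0}"
  have scale: "g x = g y \<and> (f (complexify x) = 0 \<longleftrightarrow> f (complexify y) = 0)"
    if xy: "vertex x" "vertex y" "tight x = tight y" for x y
  proof -
    obtain a where a: "a > 0" "y = a *\<^sub>R x"
      using vertex_same_tight[OF xy] by blast
    have "complexify y = of_real a *s complexify x"
      by (simp add: a complexify_def vec_eq_iff)
    then show ?thesis
      using a form_function_homogeneous[OF ff] by (simp add: g_def)
  qed
  \<comment> \<open>A vertex is determined by its tight set up to a positive factor, so \<open>g\<close> takes only finitely
    many values on vertices.\<close>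
  have "g ` B \<subseteq> (\<lambda>S. g (SOME x. vertex x \<and> tight x = S)) ` Pow I"
  proof
    fix r assume "r \<in> g ` B"
    then obtain x where x: "vertex x" "r = g x" by (auto simp: B_def)
    then have "vertex (SOME x'. vertex x' \<and> tight x' = tight x) \<and>
        tight (SOME x'. vertex x' \<and> tight x' = tight x) = tight x"
      by (intro someI[of "\<lambda>x'. vertex x' \<and> tight x' = tight x" x]) auto
    then have "r = g (SOME x'. vertex x' \<and> tight x' = tight x)"
      using scale x by metis
    then show "r \<in> (\<lambda>S. g (SOME x. vertex x \<and> tight x = S)) ` Pow I"
      using tight_subset by blast
  qed
  then have fin: "finite (g ` B)"
    by (rule finite_subset) (simp add: finite_I)
  have all: "f (complexify x) = 0" if x: "vertex x" for x
  proof (rule ccontr)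
    assume "f (complexify x) \<noteq> 0"
    then have "g ` B \<noteq> {}" using x by (auto simp: B_def)
    then obtain y where y: "y \<in> B" "\<And>y'. y' \<in> B \<Longrightarrow> g y \<le> g y'"
      using Min_in[OF fin] Min_le[OF fin] by (smt (verit, best) imageE imageI)
    then have vy: "vertex y" and fy: "f (complexify y) \<noteq> 0" by (auto simp: B_def)
    have "tight y \<noteq> tight z"
      using scale[OF vy z(1)] fy z(2) by blast
    from improving_neighbour[OF vy z(1) this, folded c_def h_def, folded g_def]
    obtain y' j k where y': "vertex y'" "j \<in> tight y" "k \<in> I - tight y"
      "tight y' = insert k (tight y - {j})" "g y' < g y"
      by blast
    then have "y' \<notin> B" using y(2)[of y'] by auto
    then have "f (complexify y') = 0" using y' by (simp add: B_def)
    then show False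
      using adjoint_form_vanishes_at_neighbour[OF f vy y'(1-4)] fy by simp
  qed
  show ?thesis
  proof (rule form_vanishes_from_points[OF ff, where S = "{}"])
    fix w assume w: "w \<noteq> 0" "Suc (card (zeros w)) = CARD('k)"
    show "f w = 0"
    proof (cases "meets_cone (zeros w)")
      case True
      then obtain x where "x \<in> cone" "x \<noteq> 0" "zeros w \<subseteq> tight x"
        by (auto simp: meets_cone_def)
      from vertex_if_tight[OF this w(2)] have x: "vertex x" "tight x = zeros w" by auto
      then obtain a where "w = a *s complexify x"
        using proportional_to_vertex[of x w] by auto
      then show ?thesis
        using form_function_homogeneous[OF ff] all[OF x(1)] by simp
    qed (use f w in \<open>simp add: adjoint_form_def\<close>)
  qed (use card_I w in auto)
qed

lemma adjoint_forms_proportional: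
  assumes f: "adjoint_form f" and g: "adjoint_form g"
    and fnz: "\<exists>w. w \<noteq> 0 \<and> f w \<noteq> 0" and gnz: "\<exists>w. w \<noteq> 0 \<and> g w \<noteq> 0"
  shows "\<exists>c. c \<noteq> 0 \<and> (\<forall>w. w \<noteq> 0 \<longrightarrow> f w = c * g w)"
proof -
  obtain z where z: "vertex z" using vertex_exists by blast
  have fz: "f (complexify z) \<noteq> 0"
    using adjoint_form_eq_0_if_vanishes_at_vertex[OF f z] fnz by blast
  have gz: "g (complexify z) \<noteq> 0"
    using adjoint_form_eq_0_if_vanishes_at_vertex[OF g z] gnz by blast
  define c where "c = f (complexify z) / g (complexify z)"
  have "adjoint_form (\<lambda>w. f w + (- c) * g w)"
    unfolding adjoint_form_def
  proof (intro conjI)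
    show "form_function (card I - CARD('k)) (\<lambda>w. f w + (- c) * g w)"
      by (intro form_function_add form_function_cmult) (use f g in \<open>auto simp: adjoint_form_def\<close>)
  qed (use f g in \<open>auto simp: adjoint_form_def\<close>)
  from adjoint_form_eq_0_if_vanishes_at_vertex[OF this z]
  have "\<forall>w. w \<noteq> 0 \<longrightarrow> f w = c * g w"
    using gz by (simp add: c_def)
  then show ?thesis
    using fz gz by (intro exI[of _ c]) (auto simp: c_def)
qed

section \<open>Existence of the adjoint form\<close>

text \<open>
  The absolute value makes the determinant independent of the order of the rows, hence a
  function of the set \<open>T\<close>.
\<close>

definition minor :: "'i set \<Rightarrow> real"
  where "minor T = \<bar>det (\<chi> r. \<alpha> ((SOME g. bij_betw g (UNIV :: 'k set) T) r))\<bar>"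

lemma minor_eq:
  assumes g: "bij_betw g (UNIV :: 'k set) T"
  shows "minor T = \<bar>det (\<chi> r. \<alpha> (g r))\<bar>"
proof -
  define g' where "g' = (SOME g. bij_betw g (UNIV :: 'k set) T)"
  have g': "bij_betw g' UNIV T"
    unfolding g'_def using g by (rule someI[of "\<lambda>g. bij_betw g (UNIV :: 'k set) T"])
  define p where "p = inv_into UNIV g' \<circ> g"
  have "bij_betw p UNIV UNIV"
    unfolding p_def using g bij_betw_inv_into[OF g'] by (rule bij_betw_trans)
  then have p: "p permutes UNIV"
    by (auto intro: bij_imp_permutes)
  have "g' (p r) = g r" for r
    using bij_betw_inv_into_right[OF g'] bij_betwE[OF g] by (simp add: p_def)
  then have "(\<chi> r. \<alpha> (g r)) = (\<chi> r. (\<chi> r. \<alpha> (g' r)) $ p r)"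
    by simp
  then have "det (\<chi> r. \<alpha> (g r)) = of_int (sign p) * det (\<chi> r. \<alpha> (g' r))"
    using det_permute_rows[OF p] by metis
  then show ?thesis
    by (simp add: minor_def g'_def abs_mult sign_def)
qed

lemma bij_betw_exists:
  assumes "T \<subseteq> I" "card T = CARD('k)"
  obtains g where "bij_betw g (UNIV :: 'k set) T"
  using finite_same_card_bij[of "UNIV::'k set" T] assms finite_subset_I by auto

lemma minor_pos:
  assumes T: "T \<subseteq> I" "card T = CARD('k)"
  shows "0 < minor T"
proof -
  obtain g where g: "bij_betw g (UNIV :: 'k set) T"
    using bij_betw_exists[OF T] by blast
  define A where "A = (\<chi> r. \<alpha> (g r))"
  have A: "(A *v x) $ r = \<alpha> (g r) \<bullet> x" for x r
    by (simp add: A_def matrix_vector_mult_def inner_vec_def)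
  have "x = 0" if "A *v x = 0" for x
  proof (rule eq_0_if_many_tight)
    show "T \<subseteq> tight x"
    proof
      fix i assume "i \<in> T"
      then obtain r where "i = g r"
        using bij_betw_imp_surj_on[OF g] by blast
      then show "i \<in> tight x"
        using A[of x r] that T \<open>i \<in> T\<close> by (auto simp: tight_def)
    qed
  qed (use T in simp)
  then have "invertible A"
    by (simp add: matrix_left_invertible_ker invertible_left_inverse)
  then show ?thesis
    using minor_eq[OF g] by (simp add: A_def invertible_det_nz)
qed

text \<open>
  Expanding the determinant along one row, with the other rows taken from \<open>U\<close>, gives a linear functional
  of that row, namely the pairing with the generalized cross product \<open>q\<close> of \<open>U\<close>.
\<close>

lemma minor_exchange:
  assumes U: "U \<subseteq> I" "Suc (card U) = CARD('k)"
  obtains q where "U \<subseteq> tight q" "\<And>j. j \<in> I - U \<Longrightarrow> minor (insert j U) = \<bar>\<alpha> j \<bullet> q\<bar>"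
proof -
  have "U \<noteq> I" using U card_I by auto
  then obtain j0 where j0: "j0 \<in> I" "j0 \<notin> U" using U by blast
  have "card (insert j0 U) = CARD('k)"
    using U j0 finite_subset_I by simp
  then obtain g where g: "bij_betw g (UNIV :: 'k set) (insert j0 U)"
    using bij_betw_exists[of "insert j0 U"] U j0 by auto
  then obtain r0 where r0: "g r0 = j0"
    using bij_betw_imp_surj_on[OF g] by (metis insertI1 rangeE)
  have inj: "inj g" using g by (simp add: bij_betw_def)
  define D where "D y = det (\<chi> r. if r = r0 then y else \<alpha> (g r))" for y
  have "linear D"
  proof (rule linearI)
    show "D (x + y) = D x + D y" for x y
      unfolding D_def by (rule det_row_add)
    show "D (c *\<^sub>R x) = c *\<^sub>R D x" for c x
      unfolding D_def scalar_mult_eq_scaleR[symmetric] real_scaleR_def by (rule det_row_mul)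
  qed
  then have D: "y \<bullet> adjoint D 1 = D y" for y
    by (simp add: adjoint_works)
  have bij: "bij_betw (g(r0 := j)) UNIV (insert j U)" if "j \<in> I - U" for j
  proof -
    have "g ` (UNIV - {r0}) = U"
      using g j0 r0 inj by (auto simp: bij_betw_def inj_def image_iff)
    then show ?thesis
      using that inj unfolding bij_betw_def
      by (auto simp: inj_on_def fun_upd_def image_iff)
  qed
  show thesis
  proof (rule that)
    show "U \<subseteq> tight (adjoint D 1)"
    proof
      fix i assume i: "i \<in> U"
      then obtain r1 where r1: "g r1 = i"
        using bij_betw_imp_surj_on[OF g] by (metis insertI2 rangeE)
      have "r0 \<noteq> r1" using r1 r0 i j0 by auto
      then have "D (\<alpha> i) = 0"
        unfolding D_def by (rule det_identical_rows) (use r1 \<open>r0 \<noteq> r1\<close> in \<open>auto simp: row_def\<close>)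
      then show "i \<in> tight (adjoint D 1)"
        using D i U by (auto simp: tight_def)
    qed
    show "minor (insert j U) = \<bar>\<alpha> j \<bullet> adjoint D 1\<bar>" if "j \<in> I - U" for j
    proof -
      have "(\<chi> r. \<alpha> ((g(r0 := j)) r)) = (\<chi> r. if r = r0 then \<alpha> j else \<alpha> (g r))"
        by (simp add: vec_eq_iff)
      then show ?thesis
        using minor_eq[OF bij[OF that]] by (simp add: D D_def)
    qed
  qed
qed

text \<open>
  Consider a residual point lying on exactly the \<open>n\<close> hyperplanes of \<open>Z\<close>. A summand \<open>S\<close> survives
  there only if \<open>Z \<subseteq> S \<union> {i0}\<close>. Since \<open>Z\<close> is not a vertex, this means that \<open>i0 \<in> Z\<close> and that \<open>S\<close> arises
  from the edge \<open>Z - {i0}\<close> by adding one form. There are two such vertices, \<open>x\<close> and \<open>y\<close>, or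
  none. The hyperplane \<open>i0\<close> meets the line of the edge outside the cone, hence in a point with
  coordinates of opposite signs relative to \<open>x\<close> and \<open>y\<close>, and so the two summands have opposite signs.
\<close>

lemma adjoint_form_exists: "\<exists>f. adjoint_form f \<and> (\<exists>w. w \<noteq> 0 \<and> f w \<noteq> 0)"
proof -
  obtain x0 where x0: "vertex x0" using vertex_exists by blast
  then obtain i0 where i0: "i0 \<in> I" "i0 \<notin> tight x0"
    using card_I_minus_tight by (auto simp: vertex_def)
  define V where "V = {S. i0 \<notin> S \<and> (\<exists>x. vertex x \<and> tight x = S)}"
  have V: "S \<subseteq> I" "Suc (card S) = CARD('k)" "finite S" "card (insert i0 S) = CARD('k)"
    "insert i0 S \<subseteq> I" if "S \<in> V" for S
    using that i0 tight_subset by (auto simp: V_def vertex_def)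
  have finV: "finite V"
    by (rule finite_subset[of _ "Pow I"]) (use V finite_I in auto)
  define trm where "trm S w =
    of_real (minor (insert i0 S)) * (\<Prod>j\<in>I - insert i0 S. pairing (\<alpha> j) w)" for S w
  define f where "f w = (\<Sum>S\<in>V. trm S w)" for w
  have trm0: "trm S w = 0" if sub: "\<not> zeros w \<subseteq> insert i0 S" for S w
  proof -
    obtain j where "j \<in> I - insert i0 S" "pairing (\<alpha> j) w = 0"
      using sub by (auto simp: zeros_def)
    then have "(\<Prod>j\<in>I - insert i0 S. pairing (\<alpha> j) w) = 0"
      using finite_I by (intro prod_zero) auto
    then show ?thesis by (simp add: trm_def)
  qed
  have ff: "form_function (card I - CARD('k)) f"
    unfolding f_def
  proof (rule form_function_sum)
    fix S assume S: "S \<in> V"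
    have "form_function (\<Sum>j\<in>I - insert i0 S. 1) (\<lambda>w. \<Prod>j\<in>I - insert i0 S. pairing (\<alpha> j) w)"
      by (intro form_function_prod form_function_pairing)
    moreover have "(\<Sum>j\<in>I - insert i0 S. 1) = card I - CARD('k)"
      using card_Diff_subset[of "insert i0 S" I] V[OF S] by simp
    ultimately show "form_function (card I - CARD('k)) (trm S)"
      unfolding trm_def by (simp add: form_function_cmult)
  qed
  have "f w = 0" if w: "w \<noteq> 0" "\<not> meets_cone (zeros w)" for w
  proof (rule form_vanishes_from_points[OF ff _ _ w(1) order.refl])
    fix w' assume w': "w' \<noteq> 0" "zeros w \<subseteq> zeros w'" "Suc (card (zeros w')) = CARD('k)"
    define Z where "Z = zeros w'"
    have cardZ: "Suc (card Z) = CARD('k)" and ZI: "Z \<subseteq> I"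
      using w' zeros_subset by (auto simp: Z_def)
    have notZ: "\<not> Z \<subseteq> tight x" if "vertex x" for x
      using that w(2) w'(2) by (auto simp: meets_cone_def vertex_def Z_def)
    have tau: "i0 \<in> Z \<and> Z - {i0} \<subseteq> S" if S: "S \<in> V" "trm S w' \<noteq> 0" for S
      using trm0[of w' S] S notZ unfolding Z_def[symmetric] V_def by blast
    show "f w' = 0"
    proof (cases "\<exists>S\<in>V. trm S w' \<noteq> 0")
      case False
      then show ?thesis by (simp add: f_def)
    next
      case True
      then obtain S x where S: "S \<in> V" "trm S w' \<noteq> 0" and x: "vertex x" "tight x = S"
        by (auto simp: V_def)
      have iZ: "i0 \<in> Z" and ZS: "Z - {i0} \<subseteq> S" using tau[OF S] by auto
      have finZ: "finite Z" by (simp add: Z_def)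
      have "card (Z - {i0}) < card S"
        using iZ cardZ V(2)[OF S(1)] card_gt_0_iff[of Z] finZ by auto
      then obtain j where j: "j \<in> S" "j \<notin> Z - {i0}"
        using ZS card_mono[of "Z - {i0}" S] finZ by fastforce
      have ji: "j \<noteq> i0" using j S by (auto simp: V_def)
      then have jZ: "j \<notin> Z" using j by auto
      have "S - {j} = Z - {i0}"
      proof (rule sym, rule card_seteq)
        show "card (S - {j}) \<le> card (Z - {i0})"
          using j(1) iZ cardZ V(2,3)[OF S(1)] finZ by simp
      qed (use ZS jZ V(3)[OF S(1)] in auto)
      then have Sj: "tight x - {j} = Z - {i0}" using x by simp
      have jx: "j \<in> tight x" using j x by simp
      obtain y k where y: "vertex y" and k: "k \<in> I - tight x" and ty: "tight y = insert k (tight x - {j})"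
        using edge_other_end[OF x(1) jx] by blast
      have ki: "k \<noteq> i0"
        using notZ[OF y] ty Sj by auto
      have kZ: "k \<notin> Z" using k ki Sj by auto
      have jk: "j \<noteq> k" using jx k by auto
      define S' where "S' = tight y"
      have S': "S' \<in> V" using ty ki y Sj by (auto simp: V_def S'_def)
      have "S \<noteq> S'" using jx x ty jk by (auto simp: S'_def)
      have only: "trm T w' = 0" if T: "T \<in> V - {S, S'}" for T
      proof (rule ccontr)
        assume nz: "trm T w' \<noteq> 0"
        then obtain z where z: "vertex z" "tight z = T" and ZT: "Z - {i0} \<subseteq> T" "i0 \<notin> T"
          using tau[of T] T by (auto simp: V_def)
        have "card (Z - {i0}) < card T"
          using iZ cardZ V(2)[of T] T card_gt_0_iff[of Z] finZ by auto
        then obtain l where l: "l \<in> T" "l \<notin> Z - {i0}"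
          using ZT card_mono[of "Z - {i0}" T] finZ by fastforce
        have Tl: "insert l (Z - {i0}) = T"
        proof (rule card_seteq)
          show "card T \<le> card (insert l (Z - {i0}))"
            using l iZ cardZ V(2)[of T] T finZ by (simp add: card_insert_if)
        qed (use ZT l V(3)[of T] T in auto)
        have "l = j \<or> l = k"
          by (rule edge_no_third_point[OF x(1) y jx k ty, of z])
             (use z Tl l Sj in \<open>auto simp: vertex_def\<close>)
        then have "T = S \<or> T = S'"
          using Tl Sj x ty jx by (auto simp: S'_def)
        then show False using T by auto
      qed
      have fsum: "f w' = trm S w' + trm S' w'"
        unfolding f_def using finV S(1) S' \<open>S \<noteq> S'\<close> only
        by (subst sum.mono_neutral_right[of V "{S, S'}"]) auto
      obtain q where q: "Z \<subseteq> tight q" "\<And>j. j \<in> I - Z \<Longrightarrow> minor (insert j Z) = \<bar>\<alpha> j \<bullet> q\<bar>"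
        using minor_exchange[OF ZI cardZ] by blast
      have jI: "j \<in> I" using jx tight_subset by blast
      have iS: "insert i0 S = insert j Z" "insert i0 S' = insert k Z"
        using Sj iZ jx x ty by (auto simp: S'_def)
      define R where "R = I - insert j (insert k Z)"
      have R: "I - insert i0 S = insert k R" "I - insert i0 S' = insert j R" "k \<notin> R" "j \<notin> R" "finite R"
        unfolding iS R_def using k jI jZ kZ jk finite_I by auto
      define P where "P = (\<Prod>i\<in>R. pairing (\<alpha> i) w')"
      have "insert j Z \<subseteq> I" "card (insert j Z) = CARD('k)"
        using jI ZI jZ cardZ finZ by auto
      then have qj: "\<alpha> j \<bullet> q \<noteq> 0"
        using minor_pos[of "insert j Z"] q(2)[of j] jI jZ by simp
      \<comment> \<open>The stratum of \<open>Z\<close> is spanned by the cross product \<open>q\<close>, so at \<open>w'\<close> the forms take the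
        same values as at \<open>q\<close> up to a common factor; at \<open>q\<close> they are minors up to sign.\<close>
      define c where "c = pairing (\<alpha> j) w' / of_real (\<alpha> j \<bullet> q)"
      have "pairing (\<alpha> i) (w' - c *s complexify q) = 0" if "i \<in> insert j Z" for i
        using that qj q(1) by (cases "i = j") (auto simp: c_def Z_def zeros_def tight_def)
      then have "insert j Z \<subseteq> zeros (w' - c *s complexify q)"
        using jI ZI by (auto simp: zeros_def)
      then have "w' - c *s complexify q = 0"
        by (rule eq_0_if_many_zeros) (use cardZ jZ finZ in simp)
      then have w'q: "w' = c *s complexify q" by simp
      have "tight x - {j} \<subseteq> tight q" using Sj q(1) by auto
      note span = edge_ends_span[OF x(1) y jx k ty this]
      have pos: "0 < \<alpha> i0 \<bullet> x" "0 < \<alpha> i0 \<bullet> y"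
        using cone_pos[of x i0] cone_pos[of y i0] i0 x y S S' by (auto simp: V_def vertex_def S'_def)
      \<comment> \<open>The coordinates of \<open>q\<close> with respect to the two ends of the edge.\<close>
      define a b where "a = (\<alpha> k \<bullet> q) / (\<alpha> k \<bullet> x)" and "b = (\<alpha> j \<bullet> q) / (\<alpha> j \<bullet> y)"
      have "\<alpha> i0 \<bullet> q = 0" using q(1) iZ tightD by blast
      then have ab: "a * (\<alpha> i0 \<bullet> x) + b * (\<alpha> i0 \<bullet> y) = 0"
        using arg_cong[OF span(1), of "\<lambda>v. \<alpha> i0 \<bullet> v"] by (simp add: a_def b_def inner_add_right)
      have "\<bar>\<alpha> j \<bullet> q\<bar> * (\<alpha> k \<bullet> q) + \<bar>\<alpha> k \<bullet> q\<bar> * (\<alpha> j \<bullet> q) = 0"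
      proof -
        have "\<alpha> k \<bullet> q = a * (\<alpha> k \<bullet> x)" "\<alpha> j \<bullet> q = b * (\<alpha> j \<bullet> y)"
          using span(2,3) by (auto simp: a_def b_def)
        moreover have "\<bar>b\<bar> * a + \<bar>a\<bar> * b = 0"
        proof (cases "0 < a")
          case True
          then have "0 < a * (\<alpha> i0 \<bullet> x)" using pos by simp
          then have "b * (\<alpha> i0 \<bullet> y) < 0" using ab by linarith
          then have "b < 0" using pos by (simp add: mult_less_0_iff)
          then show ?thesis using True by simp
        next
          case False
          then have "a * (\<alpha> i0 \<bullet> x) \<le> 0" using pos by (simp add: mult_nonpos_nonneg)
          then have "0 \<le> b * (\<alpha> i0 \<bullet> y)" using ab by linarith
          then have "0 \<le> b" using pos by (simp add: zero_le_mult_iff)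
          then show ?thesis using False by simp
        qed
        moreover have "\<bar>b * u\<bar> * (a * v) + \<bar>a * v\<bar> * (b * u) = (\<bar>b\<bar> * a + \<bar>a\<bar> * b) * (u * v)"
          if "0 < u" "0 < v" for u v :: real
          using that by (simp add: abs_mult algebra_simps)
        ultimately show ?thesis
          using span(2,3) by simp
      qed
      then have cancel: "complex_of_real \<bar>\<alpha> j \<bullet> q\<bar> * of_real (\<alpha> k \<bullet> q)
          + complex_of_real \<bar>\<alpha> k \<bullet> q\<bar> * of_real (\<alpha> j \<bullet> q) = 0"
        by (metis of_real_0 of_real_add of_real_mult)
      have "(\<Prod>i\<in>I - insert i0 S. pairing (\<alpha> i) w') = c * of_real (\<alpha> k \<bullet> q) * P"
        unfolding R(1) using R(3,5) by (simp add: P_def w'q)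
      then have "trm S w' = complex_of_real \<bar>\<alpha> j \<bullet> q\<bar> * (c * of_real (\<alpha> k \<bullet> q) * P)"
        using q(2)[of j] jI jZ by (simp add: trm_def iS(1))
      moreover have "(\<Prod>i\<in>I - insert i0 S'. pairing (\<alpha> i) w') = c * of_real (\<alpha> j \<bullet> q) * P"
        unfolding R(2) using R(4,5) by (simp add: P_def w'q)
      then have "trm S' w' = complex_of_real \<bar>\<alpha> k \<bullet> q\<bar> * (c * of_real (\<alpha> j \<bullet> q) * P)"
        using q(2)[of k] k kZ by (simp add: trm_def iS(2))
      ultimately have "f w' = c * P * (complex_of_real \<bar>\<alpha> j \<bullet> q\<bar> * of_real (\<alpha> k \<bullet> q)
          + complex_of_real \<bar>\<alpha> k \<bullet> q\<bar> * of_real (\<alpha> j \<bullet> q))"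
        unfolding fsum by (simp only: algebra_simps)
      then show ?thesis unfolding cancel by simp
    qed
  qed (use card_I in simp)
  then have adj: "adjoint_form f"
    using ff by (simp add: adjoint_form_def)
  have S0: "tight x0 \<in> V" using x0 i0 by (auto simp: V_def)
  have "trm S (complexify x0) = 0" if "S \<in> V - {tight x0}" for S
  proof (rule trm0, rule notI)
    assume "zeros (complexify x0) \<subseteq> insert i0 S"
    then have "tight x0 \<subseteq> S" using i0 by auto
    then have "tight x0 = S"
      using V[of S] V[OF S0] that by (intro card_seteq) auto
    then show False using that by simp
  qed
  then have "f (complexify x0) = trm (tight x0) (complexify x0)"
    unfolding f_def using finV S0 by (subst sum.mono_neutral_right[of V "{tight x0}"]) auto
  moreover have "trm (tight x0) (complexify x0) \<noteq> 0"
  proof -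
    have "minor (insert i0 (tight x0)) \<noteq> 0"
      using minor_pos V(4,5)[OF S0] by (metis less_irrefl)
    moreover have "(\<Prod>j\<in>I - insert i0 (tight x0). pairing (\<alpha> j) (complexify x0)) \<noteq> 0"
      using finite_I by (auto simp: prod_zero_iff tight_def)
    ultimately show ?thesis by (simp add: trm_def)
  qed
  moreover have "complexify x0 \<noteq> 0" using x0 by (simp add: vertex_def)
  ultimately show ?thesis using adj by metis
qed

end

section \<open>Homogeneous coordinates and Zariski closure\<close>

definition hom_coords :: "real ^ 'n \<Rightarrow> real ^ ('n::finite option)"
  where "hom_coords x = (\<chi> i. case i of None \<Rightarrow> 1 | Some j \<Rightarrow> x $ j)"

lemma homogenize_eq_complexify: "homogenize x = complexify (hom_coords x)"
  by (simp add: homogenize_def complexify_def hom_coords_def vec_eq_iff split: option.split)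

lemma hom_coords_nonzero: "hom_coords x \<noteq> 0"
  by (auto simp: hom_coords_def vec_eq_iff intro: exI[of _ None])

lemma hom_coords_convex:
  "u + v = 1 \<Longrightarrow> hom_coords (u *\<^sub>R x + v *\<^sub>R y) = u *\<^sub>R hom_coords x + v *\<^sub>R hom_coords y"
  by (simp add: hom_coords_def vec_eq_iff split: option.split)

lemma sum_UNIV_option: "(\<Sum>i\<in>UNIV. f i) = f None + (\<Sum>j\<in>(UNIV::'n::finite set). f (Some j))"
  by (simp add: UNIV_option_conv sum.reindex)

lemma dehomogenize:
  fixes w :: "real ^ ('n::finite option)"
  assumes "w $ None \<noteq> 0"
  obtains y where "w = (w $ None) *\<^sub>R hom_coords y"
proof (rule that[of "\<chi> j. w $ Some j / w $ None"])
  show "w = (w $ None) *\<^sub>R hom_coords (\<chi> j. w $ Some j / w $ None)"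
    using assms by (simp add: hom_coords_def vec_eq_iff split: option.split)
qed

lemma form_function_vanishes_at:
  assumes "form m F"
  shows "vanishes_at F (ppoint v) \<longleftrightarrow> mpoly_eval F v = 0"
proof -
  have f: "form_function m (mpoly_eval F)"
    using assms by (auto simp: form_function_def)
  show ?thesis
  proof
    assume "vanishes_at F (ppoint v)"
    moreover have "v \<in> ppoint v"
      unfolding ppoint_def by (rule range_eqI[of _ _ 1]) simp
    ultimately show "mpoly_eval F v = 0"
      by (simp add: vanishes_at_def)
  qed (auto simp: vanishes_at_def ppoint_def form_function_homogeneous[OF f])
qed

lemma subset_zariski_closure: "A \<subseteq> zariski_closure A"
  by (auto simp: zariski_closure_def)

lemma zariski_closure_minimal: "zariski_closed X \<Longrightarrow> A \<subseteq> X \<Longrightarrow> zariski_closure A \<subseteq> X"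
  by (auto simp: zariski_closure_def)

lemma scalar_class_map_mult:
  assumes "c \<noteq> 0"
  shows "scalar_class (Poly_Mapping.map ((*) c) F) = scalar_class F"
proof -
  have eq: "Poly_Mapping.map ((*) a) (Poly_Mapping.map ((*) b) F) = Poly_Mapping.map ((*) (a * b)) F"
    for a b :: complex
    by (rule poly_mapping_eqI) (simp add: lookup_map_mult)
  show ?thesis
  proof
    show "scalar_class (Poly_Mapping.map ((*) c) F) \<subseteq> scalar_class F"
      using assms unfolding scalar_class_def eq by force
    show "scalar_class F \<subseteq> scalar_class (Poly_Mapping.map ((*) c) F)"
    proof
      fix G assume "G \<in> scalar_class F"
      then obtain a where a: "a \<noteq> 0" "G = Poly_Mapping.map ((*) a) F"
        by (auto simp: scalar_class_def)
      then have "G = Poly_Mapping.map ((*) (a / c)) (Poly_Mapping.map ((*) c) F)"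
        using assms by (simp add: eq)
      then show "G \<in> scalar_class (Poly_Mapping.map ((*) c) F)"
        using a assms by (auto simp: scalar_class_def)
    qed
  qed
qed

section \<open>The facet arrangement of a polytope in a chart\<close>

locale polytope_in_chart =
  fixes Q :: "(real ^ 'n::finite) set" and M :: "complex ^ ('n option) ^ ('n option)"
  assumes polytope: "polytope Q" and full_dim: "aff_dim Q = int CARD('n)"
    and invertible: "invertible M"
begin

definition facets :: "(real ^ 'n) set set"
  where "facets = {C. C facet_of Q}"

text \<open>
  Any two admissible choices differ by a positive factor. The third property makes the span of
  the facet a full hyperplane.
\<close>

definition facet_form :: "(real ^ 'n) set \<Rightarrow> real ^ ('n option)"
  where "facet_form C = (SOME a. (\<forall>x\<in>Q. 0 \<le> a \<bullet> hom_coords x) \<and>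
    C = {x\<in>Q. a \<bullet> hom_coords x = 0} \<and> affine hull C = {x. a \<bullet> hom_coords x = 0})"

text \<open>
  Points are given in the coordinates of the ambient projective space; \<open>matrix_inv M\<close> brings them back to the
  coordinates of the standard chart, in which the facet forms are written.
\<close>

definition facet_hyperplane :: "(real ^ 'n) set \<Rightarrow> ('n option) ppoint set"
  where "facet_hyperplane C =
    {p\<in>proj_space. \<forall>v\<in>p. pairing (facet_form C) (matrix_inv M *v v) = 0}"

lemma polyhedron: "polyhedron Q"
  using polytope by (rule polytope_imp_polyhedron)

lemma finite_facets: "finite facets"
  unfolding facets_def by (rule finite_polytope_facets[OF polytope])

lemma facet_form:
  assumes "C \<in> facets"
  shows "\<forall>x\<in>Q. 0 \<le> facet_form C \<bullet> hom_coords x"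
    and "C = {x\<in>Q. facet_form C \<bullet> hom_coords x = 0}"
    and "affine hull C = {x. facet_form C \<bullet> hom_coords x = 0}"
proof -
  have C: "C facet_of Q" using assms by (simp add: facets_def)
  obtain a b where ab: "a \<noteq> 0" "Q \<subseteq> {x. a \<bullet> x \<le> b}" "C = Q \<inter> {x. a \<bullet> x = b}"
    using facet_of_polyhedron[OF polyhedron C] by blast
  have "aff_dim C = aff_dim {x. a \<bullet> x = b}"
    using C full_dim ab(1) by (simp add: facet_of_def)
  then have "affine hull C = affine hull {x. a \<bullet> x = b}"
    using ab(3) aff_dim_eq_full_gen[of C "{x. a \<bullet> x = b}"] by auto
  then have hull: "affine hull C = {x. a \<bullet> x = b}"
    by (simp add: affine_hyperplane hull_same)
  define v :: "real ^ ('n option)" where "v = (\<chi> i. case i of None \<Rightarrow> b | Some j \<Rightarrow> - (a $ j))"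
  have v: "v \<bullet> hom_coords x = b - a \<bullet> x" for x
    by (simp add: v_def hom_coords_def inner_vec_def sum_UNIV_option sum_negf)
  have "\<exists>a. (\<forall>x\<in>Q. 0 \<le> a \<bullet> hom_coords x) \<and> C = {x\<in>Q. a \<bullet> hom_coords x = 0} \<and>
      affine hull C = {x. a \<bullet> hom_coords x = 0}"
    by (rule exI[of _ v]) (use ab hull in \<open>auto simp: v\<close>)
  from someI_ex[OF this, folded facet_form_def]
  show "\<forall>x\<in>Q. 0 \<le> facet_form C \<bullet> hom_coords x"
    and "C = {x\<in>Q. facet_form C \<bullet> hom_coords x = 0}"
    and "affine hull C = {x. facet_form C \<bullet> hom_coords x = 0}"
    by blast+
qed

lemma Q_nonempty: "Q \<noteq> {}"
  using full_dim by auto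

lemma interior_point: "\<exists>e. e \<in> interior Q \<and> (\<forall>C\<in>facets. 0 < facet_form C \<bullet> hom_coords e)"
proof -
  have "affine hull Q = UNIV"
    using aff_dim_eq_full[of Q] full_dim by simp
  then have eq: "rel_interior Q = interior Q"
    by (rule rel_interior_interior)
  have "rel_interior Q \<noteq> {}"
    using rel_interior_eq_empty polytope_imp_convex[OF polytope] Q_nonempty by blast
  then obtain e where e: "e \<in> interior Q" using eq by auto
  have "0 < facet_form C \<bullet> hom_coords e" if C: "C \<in> facets" for C
  proof -
    have "e \<notin> C"
      using e eq rel_boundary_of_polyhedron[OF polyhedron] C by (auto simp: facets_def)
    moreover have "e \<in> Q" using e interior_subset by blast
    ultimately show ?thesis
      using facet_form(1,2)[OF C] by force
  qed
  then show ?thesis using e by blast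
qed

text \<open>
  The segment from an interior point to a point outside \<open>Q\<close> leaves \<open>Q\<close> through a facet, and the form of that
  facet is positive at the interior point, hence negative beyond the facet.
\<close>

lemma Q_eq: "x \<in> Q \<longleftrightarrow> (\<forall>C\<in>facets. 0 \<le> facet_form C \<bullet> hom_coords x)"
proof
  assume x: "\<forall>C\<in>facets. 0 \<le> facet_form C \<bullet> hom_coords x"
  obtain e where e: "e \<in> interior Q" "\<forall>C\<in>facets. 0 < facet_form C \<bullet> hom_coords e"
    using interior_point by blast
  have "affine hull Q = UNIV"
    using aff_dim_eq_full[of Q] full_dim by simp
  then have eq: "rel_interior Q = interior Q"
    by (rule rel_interior_interior)
  show "x \<in> Q"
  proof (rule ccontr)
    assume nx: "x \<notin> Q"
    have "closed_segment e x \<inter> frontier Q \<noteq> {}"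
    proof (rule connected_Int_frontier)
      show "closed_segment e x \<inter> Q \<noteq> {}" "closed_segment e x - Q \<noteq> {}"
        using e(1) interior_subset nx by auto
    qed simp
    then obtain y where y: "y \<in> closed_segment e x" "y \<in> frontier Q" by blast
    have "closed Q" using polytope by (simp add: polytope_imp_closed)
    then have "y \<in> Q - rel_interior Q" using y(2) eq by (simp add: frontier_def)
    then obtain C where C: "C \<in> facets" "y \<in> C"
      using rel_boundary_of_polyhedron[OF polyhedron] by (auto simp: facets_def)
    obtain t where t: "0 \<le> t" "t \<le> 1" "y = (1 - t) *\<^sub>R e + t *\<^sub>R x"
      using y(1) by (auto simp: in_segment)
    have "facet_form C \<bullet> hom_coords y = 0"
      using C facet_form(2) by blast
    then have "(1 - t) * (facet_form C \<bullet> hom_coords e) + t * (facet_form C \<bullet> hom_coords x) = 0"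
      unfolding t(3) by (simp add: hom_coords_convex inner_add_right)
    moreover have "0 \<le> t * (facet_form C \<bullet> hom_coords x)" using t x C by simp
    moreover have "0 \<le> (1 - t) * (facet_form C \<bullet> hom_coords e)" using t e(2) C by (simp add: less_imp_le)
    ultimately have "(1 - t) * (facet_form C \<bullet> hom_coords e) = 0" by linarith
    then have "t = 1" using e(2) C by force
    then have "y = x" using t by simp
    then show False using nx C facet_form(2) by blast
  qed
qed (use facet_form(1) in blast)

lemma no_recession:
  assumes "\<forall>C\<in>facets. 0 \<le> facet_form C \<bullet> w" "w $ None = 0"
  shows "w = 0"
proof -
  obtain e where e: "e \<in> Q" using Q_nonempty by blast
  define u :: "real ^ 'n" where "u = (\<chi> j. w $ Some j)"
  have ray: "e + s *\<^sub>R u \<in> Q" if "0 \<le> s" for s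
  proof -
    have "hom_coords (e + s *\<^sub>R u) = hom_coords e + s *\<^sub>R w"
      using assms(2) by (simp add: hom_coords_def vec_eq_iff u_def split: option.split)
    then show ?thesis
      using e assms(1) that by (simp add: Q_eq inner_add_right)
  qed
  have "bounded Q" using polytope by (simp add: polytope_imp_bounded)
  then obtain B where B: "\<And>x. x \<in> Q \<Longrightarrow> norm x \<le> B"
    by (auto simp: bounded_iff)
  have "u = 0"
  proof (rule ccontr)
    assume "u \<noteq> 0"
    have "0 \<le> B" using B[OF e] norm_ge_zero[of e] by linarith
    define s where "s = (2 * B + 1) / norm u"
    have "0 \<le> s" using \<open>0 \<le> B\<close> by (simp add: s_def)
    have "norm (s *\<^sub>R u) = 2 * B + 1"
      using \<open>u \<noteq> 0\<close> \<open>0 \<le> B\<close> by (simp add: s_def)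
    moreover have "norm (s *\<^sub>R u) \<le> norm (e + s *\<^sub>R u) + norm e"
      by (metis add_diff_cancel_left' norm_triangle_ineq4)
    ultimately show False
      using B[OF e] B[OF ray[OF \<open>0 \<le> s\<close>]] by linarith
  qed
  then have "w $ i = 0" for i
    using assms(2) by (cases i) (auto simp: u_def vec_eq_iff)
  then show ?thesis by (simp add: vec_eq_iff)
qed

text \<open>
  Boundedness of \<open>Q\<close>: the cone over \<open>Q\<close> meets the hyperplane at infinity only in the origin, and so
  every nonzero vector of the cone is a positive multiple of a point of \<open>Q\<close>. If the homogenizing coordinate
  of \<open>w\<close> were not positive, adding a nonnegative multiple of any point \<open>e\<close> of \<open>Q\<close> would move \<open>w\<close>
  to a vector of the cone at infinity, that is to \<open>0\<close>. So \<open>w\<close> would be a multiple of every point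
  of \<open>Q\<close>; but \<open>Q\<close> has more than one point.
\<close>

lemma cone_homogenizing_coordinate_pos:
  assumes w: "\<forall>C\<in>facets. 0 \<le> facet_form C \<bullet> w" "w \<noteq> 0"
  shows "0 < w $ None"
proof (rule ccontr)
  assume neg: "\<not> 0 < w $ None"
  have z: "w = (w $ None) *\<^sub>R hom_coords e" if e: "e \<in> Q" for e
  proof -
    have "w - (w $ None) *\<^sub>R hom_coords e = 0"
    proof (rule no_recession)
      show "\<forall>C\<in>facets. 0 \<le> facet_form C \<bullet> (w - (w $ None) *\<^sub>R hom_coords e)"
      proof
        fix C assume C: "C \<in> facets"
        then have "w $ None * (facet_form C \<bullet> hom_coords e) \<le> 0"
          using neg e Q_eq by (intro mult_nonpos_nonneg) auto
        then show "0 \<le> facet_form C \<bullet> (w - (w $ None) *\<^sub>R hom_coords e)"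
          using w(1) C by (simp add: inner_diff_right order.trans)
      qed
      show "(w - (w $ None) *\<^sub>R hom_coords e) $ None = 0"
        by (simp add: hom_coords_def)
    qed
    then show ?thesis by simp
  qed
  obtain e where e: "e \<in> Q" using Q_nonempty by blast
  have w0: "w $ None \<noteq> 0" using z[OF e] w(2) by auto
  have "e' = e" if "e' \<in> Q" for e'
  proof -
    have "(w $ None) *\<^sub>R hom_coords e' = (w $ None) *\<^sub>R hom_coords e"
      using z[OF e] z[OF that] by simp
    then have "hom_coords e' = hom_coords e" using w0 by simp
    then have "hom_coords e' $ Some j = hom_coords e $ Some j" for j by simp
    then show ?thesis by (simp add: hom_coords_def vec_eq_iff)
  qed
  then have "Q = {e}" using e by blast
  then show False using full_dim by simp
qed

text \<open>
  With fewer forms than coordinates the cone would contain a whole line, contradicting that its nonzero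
  vectors have positive homogenizing coordinate.
\<close>

lemma card_facets: "CARD('n option) \<le> card facets"
proof (rule ccontr)
  assume "\<not> CARD('n option) \<le> card facets"
  then have "card (facet_form ` facets) < DIM(real ^ ('n option))"
    using card_image_le[OF finite_facets, of facet_form] by simp
  then have "dim (facet_form ` facets) < DIM(real ^ ('n option))"
    using dim_le_card'[of "facet_form ` facets"] finite_facets by simp
  then obtain w where w: "w \<noteq> 0" "span (facet_form ` facets) \<subseteq> {x. w \<bullet> x = 0}"
    using lowdim_subset_hyperplane by blast
  have "facet_form C \<bullet> w = 0" if "C \<in> facets" for C
    using subsetD[OF w(2) span_base[OF imageI[OF that]]] by (simp add: inner_commute)
  then have "\<forall>C\<in>facets. 0 \<le> facet_form C \<bullet> w" "\<forall>C\<in>facets. 0 \<le> facet_form C \<bullet> (- w)"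
    by auto
  then have "0 < w $ None" "0 < (- w) $ None"
    using cone_homogenizing_coordinate_pos[of w] cone_homogenizing_coordinate_pos[of "- w"] w(1) by simp_all
  then show False by simp
qed

lemma M_inv [simp]: "matrix_inv M *v (M *v v) = v" "M *v (matrix_inv M *v v) = v"
proof -
  have "M ** matrix_inv M = mat 1 \<and> matrix_inv M ** M = mat 1"
    using invertible unfolding invertible_def matrix_inv_def by (rule someI_ex)
  then show "matrix_inv M *v (M *v v) = v" "M *v (matrix_inv M *v v) = v"
    by (simp_all add: matrix_vector_mul_assoc)
qed

lemma M_eq_0_iff [simp]: "M *v v = 0 \<longleftrightarrow> v = 0"
  by (metis M_inv(1) matrix_vector_mult_0_right)

lemma M_inv_scale: "matrix_inv M *v (c *s v) = c *s (matrix_inv M *v v)"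
  by (simp add: vec.scale)

lemma in_proj_space: "p \<in> proj_space \<longleftrightarrow> (\<exists>v. v \<noteq> 0 \<and> p = ppoint (M *v v))"
proof
  assume "p \<in> proj_space"
  then obtain u where u: "u \<noteq> 0" "p = ppoint u"
    by (auto simp: proj_space_def)
  then have "p = ppoint (M *v (matrix_inv M *v u))"
    by simp
  moreover have "matrix_inv M *v u \<noteq> 0"
    using u(1) M_inv(2)[of u] M_eq_0_iff by metis
  ultimately show "\<exists>v. v \<noteq> 0 \<and> p = ppoint (M *v v)" by blast
next
  assume "\<exists>v. v \<noteq> 0 \<and> p = ppoint (M *v v)"
  then show "p \<in> proj_space"
    using M_eq_0_iff unfolding proj_space_def by blast
qed

lemma ppoint_in_facet_hyperplane:
  assumes "v \<noteq> 0"
  shows "ppoint (M *v v) \<in> facet_hyperplane C \<longleftrightarrow> pairing (facet_form C) v = 0"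
proof
  have p: "ppoint (M *v v) \<in> proj_space"
    using assms in_proj_space by blast
  show "pairing (facet_form C) v = 0 \<Longrightarrow> ppoint (M *v v) \<in> facet_hyperplane C"
    using p by (auto simp: facet_hyperplane_def ppoint_def M_inv_scale)
  have "M *v v \<in> ppoint (M *v v)"
    unfolding ppoint_def by (rule range_eqI[of _ _ 1]) simp
  then show "ppoint (M *v v) \<in> facet_hyperplane C \<Longrightarrow> pairing (facet_form C) v = 0"
    by (auto simp: facet_hyperplane_def dest!: bspec)
qed

lemma chart_in_facet_hyperplane:
  "chart M x \<in> facet_hyperplane C \<longleftrightarrow> facet_form C \<bullet> hom_coords x = 0"
  by (simp add: chart_def homogenize_eq_complexify ppoint_in_facet_hyperplane hom_coords_nonzero)

lemma zariski_closed_facet_hyperplane: "zariski_closed (facet_hyperplane C)"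
proof -
  have "form_function 1 (\<lambda>v. pairing (facet_form C) (matrix_inv M *v v))"
    by (rule form_function_compose_matrix[OF form_function_pairing])
  then obtain F where "form 1 F" "mpoly_eval F = (\<lambda>v. pairing (facet_form C) (matrix_inv M *v v))"
    by (auto simp: form_function_def)
  then show ?thesis
    unfolding zariski_closed_def
    by (intro exI[of _ "{F}"]) (auto simp: facet_hyperplane_def vanishes_at_def)
qed

text \<open>
  Real and imaginary parts reduce the claim to real vectors. A real vector in the kernel of the form either
  comes from a point of the affine hull of the facet or is a difference of two such vectors.
\<close>

lemma span_facet:
  assumes C: "C \<in> facets" and w: "pairing (facet_form C) w = 0"
  shows "w \<in> vec.span (homogenize ` C)"
proof -
  let ?V = "vec.span (homogenize ` C)"
  have "affine {x. homogenize x \<in> ?V}"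
    unfolding affine_def
  proof (intro ballI allI impI, elim CollectE, intro CollectI)
    fix x y :: "real ^ 'n" and u v :: real
    assume xy: "homogenize x \<in> ?V" "homogenize y \<in> ?V" "u + v = 1"
    have "homogenize (u *\<^sub>R x + v *\<^sub>R y) = of_real u *s homogenize x + of_real v *s homogenize y"
      unfolding homogenize_eq_complexify hom_coords_convex[OF xy(3)]
      by (simp add: complexify_def vec_eq_iff)
    then show "homogenize (u *\<^sub>R x + v *\<^sub>R y) \<in> ?V"
      using xy by (simp add: vec.span_add vec.span_scale)
  qed
  then have "affine hull C \<subseteq> {x. homogenize x \<in> ?V}"
    by (intro hull_minimal) (auto intro: vec.span_base)
  then have hull: "homogenize y \<in> ?V" if "facet_form C \<bullet> hom_coords y = 0" for y
    using that facet_form(3)[OF C] by auto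
  have nonzero: "complexify r \<in> ?V" if r: "facet_form C \<bullet> r = 0" "r $ None \<noteq> 0" for r
  proof -
    obtain y where y: "r = (r $ None) *\<^sub>R hom_coords y" using dehomogenize[OF r(2)] by blast
    have "(r $ None) * (facet_form C \<bullet> hom_coords y) = 0"
      using r(1) y by (metis inner_scaleR_right)
    then have "homogenize y \<in> ?V" using r(2) hull by simp
    moreover have "complexify r = of_real (r $ None) *s homogenize y"
      by (subst y) (simp add: homogenize_eq_complexify complexify_def vec_eq_iff)
    ultimately show ?thesis by (simp add: vec.span_scale)
  qed
  have real: "complexify r \<in> ?V" if r: "facet_form C \<bullet> r = 0" for r
  proof (cases "r $ None = 0")
    case True
    have "C \<noteq> {}" using C by (simp add: facets_def facet_of_def)
    then obtain y where y: "y \<in> C" by blast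
    then have y0: "facet_form C \<bullet> hom_coords y = 0" using facet_form(2)[OF C] by blast
    have "complexify (r + hom_coords y) \<in> ?V"
      by (rule nonzero) (use r y0 True in \<open>auto simp: inner_add_right hom_coords_def\<close>)
    then have "complexify (r + hom_coords y) - homogenize y \<in> ?V"
      using hull[OF y0] by (rule vec.span_diff)
    moreover have "complexify (r + hom_coords y) - homogenize y = complexify r"
      by (simp add: homogenize_eq_complexify complexify_def vec_eq_iff)
    ultimately show ?thesis by simp
  qed (use nonzero r in blast)
  define re im where "re = (\<chi> i. Re (w $ i))" and "im = (\<chi> i. Im (w $ i))"
  have split: "w = complexify re + \<i> *s complexify im"
    by (simp add: re_def im_def complexify_def vec_eq_iff complex_eq[symmetric])
  have "complex_of_real (facet_form C \<bullet> re) + \<i> * complex_of_real (facet_form C \<bullet> im) = 0"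
    using w by (subst (asm) split) simp
  then have "facet_form C \<bullet> re = 0" "facet_form C \<bullet> im = 0"
    by (auto simp: complex_eq_iff)
  then show ?thesis
    by (subst split) (intro vec.span_add vec.span_scale real)
qed

lemma proj_span_facet:
  assumes C: "C \<in> facets"
  shows "proj_span (zariski_closure (chart M ` C)) = facet_hyperplane C"
proof
  let ?Z = "zariski_closure (chart M ` C)"
  have "chart M ` C \<subseteq> facet_hyperplane C"
    using chart_in_facet_hyperplane facet_form(2)[OF C] by blast
  then have Z: "?Z \<subseteq> facet_hyperplane C"
    by (rule zariski_closure_minimal[OF zariski_closed_facet_hyperplane])
  have "vec.span (\<Union>?Z) \<subseteq> {v. pairing (facet_form C) (matrix_inv M *v v) = 0}"
  proof (rule vec.span_minimal)
    show "\<Union>?Z \<subseteq> {v. pairing (facet_form C) (matrix_inv M *v v) = 0}"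
      using Z by (auto simp: facet_hyperplane_def)
    show "vec.subspace {v. pairing (facet_form C) (matrix_inv M *v v) = 0}"
      by (auto simp: vec.subspace_def matrix_vector_right_distrib M_inv_scale)
  qed
  then show "proj_span ?Z \<subseteq> facet_hyperplane C"
    by (auto simp: proj_span_def facet_hyperplane_def)
  show "facet_hyperplane C \<subseteq> proj_span ?Z"
  proof
    fix p assume p: "p \<in> facet_hyperplane C"
    have "M *v w \<in> vec.span (\<Union>?Z)" if "w \<in> vec.span (homogenize ` C)" for w
    proof -
      have "vec.span (homogenize ` C) \<subseteq> {w. M *v w \<in> vec.span (\<Union>?Z)}"
      proof (rule vec.span_minimal)
        have "M *v homogenize x \<in> vec.span (\<Union>?Z)" if "x \<in> C" for x
        proof (rule vec.span_base, rule UnionI)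
          show "chart M x \<in> ?Z" using subsetD[OF subset_zariski_closure imageI[OF that]] .
          show "M *v homogenize x \<in> chart M x"
            unfolding chart_def ppoint_def by (rule range_eqI[of _ _ 1]) simp
        qed
        then show "homogenize ` C \<subseteq> {w. M *v w \<in> vec.span (\<Union>?Z)}" by blast
        show "vec.subspace {w. M *v w \<in> vec.span (\<Union>?Z)}"
          by (auto simp: vec.subspace_def matrix_vector_right_distrib vec.scale
              intro: vec.span_add vec.span_scale vec.span_zero)
      qed
      then show ?thesis using that by blast
    qed
    then have "v \<in> vec.span (\<Union>?Z)" if "pairing (facet_form C) (matrix_inv M *v v) = 0" for v
      using span_facet[OF C that] M_inv(2) by metis
    then show "p \<in> proj_span ?Z"
      using p by (auto simp: proj_span_def facet_hyperplane_def)
  qed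
qed

lemma inj_facet_hyperplane: "inj_on facet_hyperplane facets"
proof (rule inj_onI)
  fix C D assume CD: "C \<in> facets" "D \<in> facets" "facet_hyperplane C = facet_hyperplane D"
  then have "x \<in> C \<longleftrightarrow> x \<in> D" for x
    using chart_in_facet_hyperplane[of x C] chart_in_facet_hyperplane[of x D]
      facet_form(2)[of C] facet_form(2)[of D] by blast
  then show "C = D" by blast
qed

lemma facet_arrangement_eq: "facet_arrangement M Q = facet_hyperplane ` facets"
proof -
  have "proj_facets M Q = (\<lambda>C. zariski_closure (chart M ` C)) ` facets"
    by (auto simp: proj_facets_def facets_def)
  then show ?thesis
    by (simp add: facet_arrangement_def image_image proj_span_facet)
qed

lemma card_proj_facets: "card (proj_facets M Q) = card facets"
proof -
  have eq: "proj_facets M Q = (\<lambda>C. zariski_closure (chart M ` C)) ` facets"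
    by (auto simp: proj_facets_def facets_def)
  have "inj_on (\<lambda>C. zariski_closure (chart M ` C)) facets"
  proof (rule inj_onI)
    fix C D assume CD: "C \<in> facets" "D \<in> facets"
      "zariski_closure (chart M ` C) = zariski_closure (chart M ` D)"
    then have "facet_hyperplane C = facet_hyperplane D"
      using proj_span_facet[OF CD(1)] proj_span_facet[OF CD(2)] by simp
    then show "C = D" using inj_facet_hyperplane CD by (auto dest: inj_onD)
  qed
  then show ?thesis unfolding eq by (rule card_image)
qed

lemma facet_forms_in_general_position:
  assumes "simple_arrangement (facet_arrangement M Q)"
  shows "simple_cone facets facet_form"
proof
  show "finite facets" by (rule finite_facets)
  show "CARD('n option) \<le> card facets" by (rule card_facets)
  obtain x where "x \<in> Q" using Q_nonempty by blast
  then show "\<exists>x. x \<noteq> 0 \<and> (\<forall>i\<in>facets. 0 \<le> facet_form i \<bullet> x)"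
    using hom_coords_nonzero Q_eq by blast
  fix w :: "complex ^ ('n option)" assume w: "w \<noteq> 0"
  let ?T = "{C\<in>facets. pairing (facet_form C) w = 0}"
  have "{H \<in> facet_arrangement M Q. ppoint (M *v w) \<in> H} = facet_hyperplane ` ?T"
    unfolding facet_arrangement_eq using ppoint_in_facet_hyperplane[OF w] by blast
  moreover have "card (facet_hyperplane ` ?T) = card ?T"
    by (rule card_image) (rule inj_on_subset[OF inj_facet_hyperplane], auto)
  moreover have "ppoint (M *v w) \<in> proj_space" using w in_proj_space by blast
  ultimately have "card ?T \<le> CARD('n)"
    using assms by (auto simp: simple_arrangement_def)
  then show "card ?T < CARD('n option)" by simp
qed

section \<open>The residual arrangement\<close>

text \<open>
  A linear space of the arrangement contains a face iff the hyperplanes cutting it out have a common point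
  with \<open>Q\<close>, since the intersection of the corresponding facets is then a face. A point belongs to some
  residual space iff the smallest space of the arrangement through it is residual.
\<close>

lemma residual_iff:
  assumes sc: "simple_cone facets facet_form" and v: "v \<noteq> 0"
  shows "ppoint (M *v v) \<in> residual_arrangement M Q \<longleftrightarrow>
    \<not> simple_cone.meets_cone facets facet_form (simple_cone.zeros facets facet_form v)"
proof -
  interpret simple_cone facets facet_form by (rule sc)
  show ?thesis
  proof
    assume "ppoint (M *v v) \<in> residual_arrangement M Q"
    then obtain L S where L: "S \<noteq> {}" "S \<subseteq> facet_arrangement M Q" "L = \<Inter>S"
      "\<not> (\<exists>X\<in>proj_polytope M Q. X \<subseteq> L)" "ppoint (M *v v) \<in> L"
      unfolding residual_arrangement_def by (elim UnionE CollectE conjE exE) (rule that)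
    note S = L(2) L(4)[unfolded L(3)] L(5)[unfolded L(3)] L(1)
    then obtain T where T: "T \<subseteq> facets" "S = facet_hyperplane ` T"
      unfolding facet_arrangement_eq by (auto simp: subset_image_iff)
    have Tz: "T \<subseteq> zeros v"
      using S(3) T ppoint_in_facet_hyperplane[OF v] by (auto simp: zeros_def)
    show "\<not> meets_cone (zeros v)"
    proof
      assume "meets_cone (zeros v)"
      then obtain x where x: "x \<in> cone" "x \<noteq> 0" "zeros v \<subseteq> tight x"
        by (auto simp: meets_cone_def)
      have pos: "0 < x $ None"
        using cone_homogenizing_coordinate_pos x by (simp add: cone_def)
      then obtain y where y: "x = (x $ None) *\<^sub>R hom_coords y"
        using dehomogenize by (metis less_irrefl)
      have scale: "facet_form C \<bullet> x = (x $ None) * (facet_form C \<bullet> hom_coords y)" for C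
        by (subst y) simp
      have yQ: "y \<in> Q"
        using x(1) pos by (auto simp: Q_eq cone_def scale zero_le_mult_iff)
      have yC: "y \<in> C" if "C \<in> T" for C
      proof -
        have "C \<in> tight x" using that Tz x(3) by blast
        then have "facet_form C \<bullet> hom_coords y = 0" "C \<in> facets"
          using pos by (auto simp: tight_def scale)
        then show ?thesis using facet_form(2) yQ by blast
      qed
      have "T \<noteq> {}" using S(4) T by auto
      then have "\<Inter>T face_of Q"
        using T by (intro face_of_Inter) (auto simp: facets_def facet_of_def)
      moreover have "\<Inter>T \<noteq> {}" using yC by blast
      ultimately have "zariski_closure (chart M ` \<Inter>T) \<in> proj_polytope M Q"
        by (auto simp: proj_polytope_def)
      moreover have "zariski_closure (chart M ` \<Inter>T) \<subseteq> \<Inter>S"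
      proof (rule Inter_greatest)
        fix H assume "H \<in> S"
        then obtain C where C: "C \<in> T" "H = facet_hyperplane C" using T by blast
        then have "chart M ` \<Inter>T \<subseteq> H"
          using chart_in_facet_hyperplane facet_form(2)[of C] T by blast
        then show "zariski_closure (chart M ` \<Inter>T) \<subseteq> H"
          using C zariski_closure_minimal[OF zariski_closed_facet_hyperplane] by blast
      qed
      ultimately show False using S(2) by blast
    qed
  next
    assume nm: "\<not> meets_cone (zeros v)"
    let ?S = "facet_hyperplane ` zeros v"
    have "meets_cone {}"
      using nontrivial by (auto simp: meets_cone_def cone_def)
    then have "?S \<noteq> {}" using nm by auto
    moreover have "?S \<subseteq> facet_arrangement M Q"
      unfolding facet_arrangement_eq using zeros_subset by blast
    moreover have "\<not> X \<subseteq> \<Inter>?S" if "X \<in> proj_polytope M Q" for X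
    proof
      assume sub: "X \<subseteq> \<Inter>?S"
      obtain F where F: "X = zariski_closure (chart M ` F)" "F face_of Q" "F \<noteq> {}"
        using \<open>X \<in> proj_polytope M Q\<close> by (auto simp: proj_polytope_def)
      then obtain y where y: "y \<in> F" "y \<in> Q" using face_of_imp_subset by blast
      have "chart M y \<in> \<Inter>?S" using sub F y subset_zariski_closure by blast
      then have "zeros v \<subseteq> tight (hom_coords y)"
        using zeros_subset by (auto simp: chart_in_facet_hyperplane tight_def)
      then have "meets_cone (zeros v)"
        using y(2) hom_coords_nonzero by (auto simp: meets_cone_def cone_def Q_eq)
      then show False using nm by blast
    qed
    moreover have "ppoint (M *v v) \<in> \<Inter>?S"
      using ppoint_in_facet_hyperplane[OF v] by (auto simp: zeros_def)
    ultimately show "ppoint (M *v v) \<in> residual_arrangement M Q"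
      unfolding residual_arrangement_def
      by (intro UnionI[of "\<Inter>?S"] CollectI conjI exI[of _ ?S]) auto
  qed
qed

lemma residual_in_proj_space: "residual_arrangement M Q \<subseteq> proj_space"
proof
  fix p assume "p \<in> residual_arrangement M Q"
  then obtain L S where "S \<noteq> {}" "S \<subseteq> facet_arrangement M Q" "L = \<Inter>S" "p \<in> L"
    unfolding residual_arrangement_def by (elim UnionE CollectE conjE exE) (rule that)
  then obtain C where "p \<in> facet_hyperplane C"
    unfolding facet_arrangement_eq by blast
  then show "p \<in> proj_space" by (simp add: facet_hyperplane_def)
qed

end

theorem theorem1p5:
  fixes Q :: "(real ^ 'n::finite) set"
    and M :: "complex ^ ('n option) ^ ('n option)"
    and d :: nat
  assumes "polytope Q" and "aff_dim Q = int CARD('n)"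
    and "invertible M"
    and "card (proj_facets M Q) = d"
    and "simple_arrangement (facet_arrangement M Q)"
  shows "\<exists>!A. A \<in> hypersurfaces (d - CARD('n) - 1) \<and> vanishes_along A (residual_arrangement M Q)"
proof -
  interpret polytope_in_chart Q M
    by (rule polytope_in_chart.intro) (rule assms)+
  have sc: "simple_cone facets facet_form"
    by (rule facet_forms_in_general_position) (rule assms)
  interpret simple_cone facets facet_form by (rule sc)
  let ?m = "card facets - CARD('n option)"
  let ?R = "residual_arrangement M Q"
  have m: "d - CARD('n) - 1 = ?m"
    using assms(4) card_proj_facets by simp
  have adjoint_iff: "adjoint_form (\<lambda>v. mpoly_eval F (M *v v)) \<longleftrightarrow> (\<forall>p\<in>?R. vanishes_at F p)"
    if F: "form ?m F" for F
  proof -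
    have ff: "form_function ?m (\<lambda>v. mpoly_eval F (M *v v))"
      by (rule form_function_compose_matrix) (use F in \<open>auto simp: form_function_def\<close>)
    have "(\<forall>p\<in>?R. vanishes_at F p) \<longleftrightarrow>
        (\<forall>v. v \<noteq> 0 \<longrightarrow> \<not> meets_cone (zeros v) \<longrightarrow> mpoly_eval F (M *v v) = 0)"
    proof safe
      fix v :: "complex ^ ('n option)"
      assume "\<forall>p\<in>?R. vanishes_at F p" "v \<noteq> 0" "\<not> meets_cone (zeros v)"
      then show "mpoly_eval F (M *v v) = 0"
        using residual_iff[OF sc, of v] form_function_vanishes_at[OF F, of "M *v v"] by blast
    next
      fix p assume *: "\<forall>v. v \<noteq> 0 \<longrightarrow> \<not> meets_cone (zeros v) \<longrightarrow> mpoly_eval F (M *v v) = 0"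
        and p: "p \<in> ?R"
      then obtain v where v: "v \<noteq> 0" "p = ppoint (M *v v)"
        using residual_in_proj_space in_proj_space by blast
      then show "vanishes_at F p"
        using * p residual_iff[OF sc v(1)] form_function_vanishes_at[OF F, of "M *v v"] by simp
    qed
    then show ?thesis using ff by (simp add: adjoint_form_def)
  qed
  have nonzero: "\<exists>w. w \<noteq> 0 \<and> mpoly_eval F (M *v w) \<noteq> 0" if F0: "F \<noteq> 0" for F
  proof -
    obtain v where v: "v \<noteq> 0" "mpoly_eval F v \<noteq> 0"
      using mpoly_eq_0_if_eval_0[of F] F0 by blast
    have "matrix_inv M *v v \<noteq> 0"
      using v(1) M_inv(2)[of v] M_eq_0_iff by metis
    then show ?thesis
      using v(2) by (intro exI[of _ "matrix_inv M *v v"]) simp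
  qed
  show ?thesis
    unfolding m
  proof (rule ex_ex1I)
    obtain f w where f: "adjoint_form f" and w: "f w \<noteq> 0"
      using adjoint_form_exists by blast
    have "form_function ?m (\<lambda>v. f (matrix_inv M *v v))"
      by (rule form_function_compose_matrix) (use f in \<open>simp add: adjoint_form_def\<close>)
    then obtain F where F: "form ?m F" "mpoly_eval F = (\<lambda>v. f (matrix_inv M *v v))"
      by (auto simp: form_function_def)
    have "mpoly_eval F (M *v w) \<noteq> 0" using F w by simp
    then have "F \<noteq> 0" by (auto simp: mpoly_eval_def)
    moreover have "\<forall>p\<in>?R. vanishes_at F p"
      using adjoint_iff[OF F(1)] f by (simp add: F(2))
    then have "vanishes_along (scalar_class F) ?R"
      by (auto simp: vanishes_along_def scalar_class_def vanishes_at_def mpoly_eval_map_mult)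
    ultimately show "\<exists>A. A \<in> hypersurfaces ?m \<and> vanishes_along A ?R"
      using F(1) by (auto simp: hypersurfaces_def)
  next
    fix A B
    assume A: "A \<in> hypersurfaces ?m \<and> vanishes_along A ?R"
      and B: "B \<in> hypersurfaces ?m \<and> vanishes_along B ?R"
    obtain F where F: "form ?m F" "F \<noteq> 0" "A = scalar_class F"
      using A by (auto simp: hypersurfaces_def)
    obtain G where G: "form ?m G" "G \<noteq> 0" "B = scalar_class G"
      using B by (auto simp: hypersurfaces_def)
    have self: "H \<in> scalar_class H" for H :: "'n option mpoly"
    proof -
      have "H = Poly_Mapping.map ((*) 1) H"
        by (rule poly_mapping_eqI) (simp add: lookup_map_mult)
      then show ?thesis
        unfolding scalar_class_def by (intro CollectI exI[of _ 1] conjI) auto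
    qed
    have "adjoint_form (\<lambda>v. mpoly_eval F (M *v v))" "adjoint_form (\<lambda>v. mpoly_eval G (M *v v))"
      using A B F(3) G(3) self[of F] self[of G]
      unfolding adjoint_iff[OF F(1)] adjoint_iff[OF G(1)] vanishes_along_def by blast+
    from adjoint_forms_proportional[OF this nonzero[OF F(2)] nonzero[OF G(2)]]
    obtain c where c: "c \<noteq> 0" "\<And>v. v \<noteq> 0 \<Longrightarrow> mpoly_eval F (M *v v) = c * mpoly_eval G (M *v v)"
      by blast
    have diff: "F + Poly_Mapping.map ((*) (- c)) G = 0"
    proof (rule mpoly_eq_0_if_eval_0)
      fix v :: "complex ^ ('n option)" assume "v \<noteq> 0"
      then have "matrix_inv M *v v \<noteq> 0"
        using M_inv(2)[of v] M_eq_0_iff by metis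
      from c(2)[OF this] show "mpoly_eval (F + Poly_Mapping.map ((*) (- c)) G) v = 0"
        by (simp add: mpoly_eval_add mpoly_eval_map_mult)
    qed
    have "Poly_Mapping.lookup F t + - c * Poly_Mapping.lookup G t = 0" for t
      using arg_cong[of _ _ "\<lambda>H. Poly_Mapping.lookup H t", OF diff]
      by (simp add: lookup_add lookup_map_mult)
    then have "F = Poly_Mapping.map ((*) c) G"
      by (intro poly_mapping_eqI) (simp add: lookup_map_mult)
    then show "A = B"
      using F(3) G(3) scalar_class_map_mult[OF c(1)] by simp
  qed
qed

end
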